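(* Let $y\in Y$, $f\in\mathfrak A$ and $\omega_p\in S_*(\mathfrak A)$ with $\omega_p(F(y))\neq0$. Let $\omega_\rho=\Gamma(\omega_p)$ and $\omega_{\rho_L}=\mathbf\Pi_L'\omega_\rho$. Then $$\lim_{L\to\infty}\omega_{\rho_L}|_{\mathcal F_L(y)}(\pi f)=\omega_\rho|_{\mathcal F(y)}(\pi f)=\omega_p|_{F(y)}f.$$
   Context: Let $X$ be a completely metrizable, separable space with a Borel probability measure $\mu$ (ergodic and invariant under a dynamical flow $\Phi^t:X\to X$). Put $H=L^2(X,\mu)$, $\langle f,g\rangle=\int_Xf^*g\,d\mu$; $\mathfrak A=L^\infty(X,\mu)$, $\mathfrak A_*=L^1(X,\mu)$; $\mathfrak B=B(H)$, $\mathfrak B_*=B_1(H)$ (trace class). A probability density $p\in\mathfrak A_*$ ($p\ge0$, $\int_X p\,d\mu=1$) induces the normal state $\omega_pf=\int_Xfp\,d\mu$; a density operator $\rho$ (positive, trace 1) induces $\omega_\rho A=\operatorname{tr}(\rho A)$. $S_*(\cdot)$ denotes sets of normal states. $\pi:\mathfrak A\to\mathfrak B$, $(\pi f)g=fg$. $\Gamma(\omega_p)=\omega_\rho$ with $\rho=\langle\sqrt p,\cdot\rangle\sqrt p$. Fix an orthonormal basis $\{\phi_0,\phi_1,\ldots\}$ of $H$ with $\phi_j\in\mathfrak A$; $H_L=\operatorname{span}\{\phi_0,\ldots,\phi_{L-1}\}$; $\Pi_L$ is the orthogonal projection onto $H_L$; $\mathbf\Pi_LA=\Pi_LA\Pi_L$;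 $\mathfrak B_L=B(H_L)$, identified with $\{\Pi_LA\Pi_L:A\in\mathfrak B\}\subseteq\mathfrak B$. For a density operator $\rho$ and $L$ large enough that $\operatorname{tr}(\mathbf\Pi_L\rho)>0$, $\rho_L=\mathbf\Pi_L\rho/\operatorname{tr}(\mathbf\Pi_L\rho)$ and $\mathbf\Pi'_L\omega_\rho=\omega_{\rho_L}$. States $\omega_\sigma$ of $\mathfrak B_L$ are extended to $\mathfrak B$ by $\omega_\sigma A=\operatorname{tr}(\sigma A)$. An effect in a unital $C^*$-algebra $\mathfrak W$ is $e$ with $0\le e\le I$; $\mathcal E(\mathfrak W)$ is the set of effects. For a normal state $\omega_\rho$ and effect $e$ with $\omega_\rho e\neq0$, the conditional state $\omega_\rho|_e$ is the normal state induced by $\rho|_e=\sqrt e\,\rho\sqrt e/(\omega_\rho e)$ (this applies in $\mathfrak A$, $\mathfrak B$, $\mathfrak B_L$; the expression is defined for all sufficiently large $L$ in the limit above). Observations: $h:X\to Y$ is a measurable observation map, $\psi:Y\times Y\to[0,1]$ a measurable kernel; $F:Y\to\mathcal E(\mathfrak A)$, $F(y)=\psi(y,h(\cdot))$; $\mathcal F=\pi\circ F:Y\to\mathcal E(\mathfrak B)$; $\mathcal F_L=\mathbf\Pi_L\circ\mathcal F:Y\to\mathcal E(\mathfrak B_L)$. *)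

theory Defs
  imports "HOL-Probability.Probability"
begin

text \<open>
  Ergodicity is only required for strictly invariant sets, and the flow need only be measurable
  for each fixed time: these are the weakest of the usual formulations.
\<close>

locale ergodic_flow = prob_space M for M :: "'x::polish_space measure" +
  fixes \<Phi> :: "real \<Rightarrow> 'x \<Rightarrow> 'x"
  assumes sets_eq_borel: "sets M = sets borel"
    and flow_zero: "\<Phi> 0 x = x"
    and flow_add: "\<Phi> (s + t) x = \<Phi> s (\<Phi> t x)"
    and flow_measurable: "\<Phi> t \<in> measurable M M"
    and flow_invariant: "distr M M (\<Phi> t) = M"
    and flow_ergodic: "S \<in> sets M \<Longrightarrow> (\<And>t. \<Phi> t -` S = S) \<Longrightarrow> measure M S = 0 \<or> measure M S = 1"

text \<open>
  Elements of the Lebesgue spaces are represented by functions; two representatives denote the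
  same element iff they agree almost everywhere. All notions below respect this identification.
  Positivity in the complex function algebra is membership in \<open>\<real>\<^sub>\<ge>\<^sub>0\<close>, so \<open>csqrt\<close> is the
  square root of the algebra on positive elements.
\<close>

definition ae_eq :: "'x measure \<Rightarrow> ('x \<Rightarrow> complex) \<Rightarrow> ('x \<Rightarrow> complex) \<Rightarrow> bool" where
  "ae_eq M f g \<longleftrightarrow> (AE x in M. f x = g x)"

definition Linf :: "'x measure \<Rightarrow> ('x \<Rightarrow> complex) set" where
  "Linf M = {f \<in> borel_measurable M. \<exists>C. AE x in M. norm (f x) \<le> C}"

definition prob_density :: "'x measure \<Rightarrow> ('x \<Rightarrow> complex) \<Rightarrow> bool" where
  "prob_density M p \<longleftrightarrow>
     integrable M p \<and> (AE x in M. p x \<in> \<real>\<^sub>\<ge>\<^sub>0) \<and> (\<integral>x. p x \<partial>M) = 1"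

definition fun_state :: "'x measure \<Rightarrow> ('x \<Rightarrow> complex) \<Rightarrow> ('x \<Rightarrow> complex) \<Rightarrow> complex" where
  "fun_state M p f = (\<integral>x. f x * p x \<partial>M)"

definition fun_cond ::
    "'x measure \<Rightarrow> ('x \<Rightarrow> complex) \<Rightarrow> ('x \<Rightarrow> complex) \<Rightarrow> 'x \<Rightarrow> complex" where
  "fun_cond M p e = (\<lambda>x. csqrt (e x) * p x * csqrt (e x) / fun_state M p e)"

definition L2 :: "'x measure \<Rightarrow> ('x \<Rightarrow> complex) set" where
  "L2 M = {f \<in> borel_measurable M. integrable M (\<lambda>x. (norm (f x))\<^sup>2)}"

definition L2_inner :: "'x measure \<Rightarrow> ('x \<Rightarrow> complex) \<Rightarrow> ('x \<Rightarrow> complex) \<Rightarrow> complex" where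
  "L2_inner M f g = (\<integral>x. cnj (f x) * g x \<partial>M)"

definition L2_norm :: "'x measure \<Rightarrow> ('x \<Rightarrow> complex) \<Rightarrow> real" where
  "L2_norm M f = sqrt (\<integral>x. (norm (f x))\<^sup>2 \<partial>M)"

definition span_upto :: "(nat \<Rightarrow> 'x \<Rightarrow> complex) \<Rightarrow> nat \<Rightarrow> ('x \<Rightarrow> complex) set" where
  "span_upto \<phi> L = {(\<lambda>x. \<Sum>j<L. c j * \<phi> j x) | c. True}"

definition orthonormal_basis :: "'x measure \<Rightarrow> (nat \<Rightarrow> 'x \<Rightarrow> complex) \<Rightarrow> bool" where
  "orthonormal_basis M \<phi> \<longleftrightarrow>
     (\<forall>j. \<phi> j \<in> L2 M) \<and>
     (\<forall>i j. L2_inner M (\<phi> i) (\<phi> j) = (if i = j then 1 else 0)) \<and>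
     (\<forall>f\<in>L2 M. \<forall>\<epsilon>>0. \<exists>L. \<exists>g\<in>span_upto \<phi> L. L2_norm M (\<lambda>x. f x - g x) < \<epsilon>)"

text \<open>
  Orthogonal projection onto the span of the first \<open>L\<close> basis functions. The functions
  \<open>\<phi> j\<close> are independent modulo null sets, so the representative in \<open>span_upto \<phi> L\<close> is unique.
\<close>

definition proj :: "'x measure \<Rightarrow> (nat \<Rightarrow> 'x \<Rightarrow> complex) \<Rightarrow> nat \<Rightarrow>
    ('x \<Rightarrow> complex) \<Rightarrow> ('x \<Rightarrow> complex)" where
  "proj M \<phi> L f = (THE g. g \<in> span_upto \<phi> L \<and>
     (\<forall>k\<in>span_upto \<phi> L. L2_inner M k (\<lambda>x. f x - g x) = 0))"

type_synonym 'x op = "('x \<Rightarrow> complex) \<Rightarrow> ('x \<Rightarrow> complex)"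

definition bounded_op :: "'x measure \<Rightarrow> 'x op \<Rightarrow> bool" where
  "bounded_op M A \<longleftrightarrow>
     (\<forall>f\<in>L2 M. A f \<in> L2 M) \<and>
     (\<forall>f\<in>L2 M. \<forall>g\<in>L2 M. ae_eq M f g \<longrightarrow> ae_eq M (A f) (A g)) \<and>
     (\<forall>f\<in>L2 M. \<forall>g\<in>L2 M. ae_eq M (A (\<lambda>x. f x + g x)) (\<lambda>x. A f x + A g x)) \<and>
     (\<forall>f\<in>L2 M. \<forall>c. ae_eq M (A (\<lambda>x. c * f x)) (\<lambda>x. c * A f x)) \<and>
     (\<exists>C. \<forall>f\<in>L2 M. L2_norm M (A f) \<le> C * L2_norm M f)"

definition positive_op :: "'x measure \<Rightarrow> 'x op \<Rightarrow> bool" where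
  "positive_op M A \<longleftrightarrow> bounded_op M A \<and> (\<forall>f\<in>L2 M. L2_inner M f (A f) \<in> \<real>\<^sub>\<ge>\<^sub>0)"

text \<open>
  The positive square root, unique as an operator, i.e. up to almost-everywhere equality of its
  values on \<open>L2 M\<close>. For a positive element of the corner algebra of operators on
  \<open>span_upto \<phi> L\<close> it is also the square root in that algebra.
\<close>

definition op_sqrt :: "'x measure \<Rightarrow> 'x op \<Rightarrow> 'x op" where
  "op_sqrt M A = (SOME R. positive_op M R \<and> (\<forall>f\<in>L2 M. ae_eq M (R (R f)) (A f)))"

text \<open>The sum of the diagonal entries, which for a trace class operator is the same in every basis.\<close>

definition op_trace :: "'x measure \<Rightarrow> 'x op \<Rightarrow> complex" where
  "op_trace M A =
     (THE t. \<forall>e. orthonormal_basis M e \<longrightarrow> (\<lambda>j. L2_inner M (e j) (A (e j))) sums t)"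

definition op_state :: "'x measure \<Rightarrow> 'x op \<Rightarrow> 'x op \<Rightarrow> complex" where
  "op_state M \<rho> A = op_trace M (\<rho> \<circ> A)"

definition op_cond :: "'x measure \<Rightarrow> 'x op \<Rightarrow> 'x op \<Rightarrow> 'x op" where
  "op_cond M \<rho> e = (\<lambda>g x. (op_sqrt M e \<circ> \<rho> \<circ> op_sqrt M e) g x / op_state M \<rho> e)"

definition mult_op :: "('x \<Rightarrow> complex) \<Rightarrow> 'x op" where
  "mult_op f = (\<lambda>g x. f x * g x)"

text \<open>The density operator inducing the image under \<open>\<Gamma>\<close> of the state with density \<open>p\<close>.\<close>

definition Gamma_density :: "'x measure \<Rightarrow> ('x \<Rightarrow> complex) \<Rightarrow> 'x op" where
  "Gamma_density M p = (\<lambda>g x. L2_inner M (\<lambda>z. csqrt (p z)) g * csqrt (p x))"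

definition compress :: "'x measure \<Rightarrow> (nat \<Rightarrow> 'x \<Rightarrow> complex) \<Rightarrow> nat \<Rightarrow> 'x op \<Rightarrow> 'x op" where
  "compress M \<phi> L A = proj M \<phi> L \<circ> A \<circ> proj M \<phi> L"

definition compress_density ::
    "'x measure \<Rightarrow> (nat \<Rightarrow> 'x \<Rightarrow> complex) \<Rightarrow> nat \<Rightarrow> 'x op \<Rightarrow> 'x op" where
  "compress_density M \<phi> L \<rho> = (\<lambda>g x. compress M \<phi> L \<rho> g x / op_trace M (compress M \<phi> L \<rho>))"

definition obs_effect ::
    "('y \<times> 'y \<Rightarrow> real) \<Rightarrow> ('x \<Rightarrow> 'y) \<Rightarrow> 'y \<Rightarrow> 'x \<Rightarrow> complex" where
  "obs_effect \<psi> h y = (\<lambda>x. complex_of_real (\<psi> (y, h x)))"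

definition obs_effect_op :: "('y \<times> 'y \<Rightarrow> real) \<Rightarrow> ('x \<Rightarrow> 'y) \<Rightarrow> 'y \<Rightarrow> 'x op" where
  "obs_effect_op \<psi> h y = mult_op (obs_effect \<psi> h y)"

definition obs_effect_proj :: "'x measure \<Rightarrow> (nat \<Rightarrow> 'x \<Rightarrow> complex) \<Rightarrow>
    ('y \<times> 'y \<Rightarrow> real) \<Rightarrow> ('x \<Rightarrow> 'y) \<Rightarrow> nat \<Rightarrow> 'y \<Rightarrow> 'x op" where
  "obs_effect_proj M \<phi> \<psi> h L y = compress M \<phi> L (obs_effect_op \<psi> h y)"

end

theory Submission
  imports Defs
begin

text \<open>
  Conditioning a rank one density operator is explicit. If \<open>\<rho> g = c \<langle>u, g\<rangle> u\<close> and \<open>R\<close> is the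
  positive square root of an effect \<open>A\<close>, then both traces in the conditional state are traces of
  rank one operators, the factor \<open>c\<close> cancels, and the state of multiplication by \<open>f\<close> is
  \<open>\<langle>R u, f R u\<rangle> / \<langle>u, A u\<rangle>\<close> (\<open>op_state_cond_rank_one\<close>). With \<open>u = \<surd>p\<close> and \<open>A\<close> multiplication by
  the observation effect \<open>e\<close>, the root is multiplication by \<open>\<surd>e\<close>, and the quotient is
  \<open>\<integral> f e p / \<integral> e p\<close>; this is the second equation of the theorem.

  The compressed density is again of rank one, with \<open>u\<close> replaced by its projection \<open>u\<^sub>L\<close>
  and \<open>A\<close> by its compression \<open>A\<^sub>L\<close>. Since \<open>u\<^sub>L \<rightarrow> u\<close> in norm and
  \<open>A\<^sub>L \<rightarrow> A\<close> strongly, the limit follows once \<open>R\<^sub>L u\<^sub>L \<rightarrow> R u\<close>, that is, once the square root is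
  known to be strongly continuous on effects. The compressions need not commute with one another, so
  \<open>R\<^sub>L\<close> has to be controlled uniformly in \<open>L\<close>.

  All facts needed on square roots come from one iteration. Put \<open>B = 1 - A\<close>, \<open>Y\<^sub>0 = 0\<close> and
  \<open>Y\<^sub>n\<^sub>+\<^sub>1 = (B + Y\<^sub>n\<^sup>2) / 2\<close>, and let \<open>a\<^sub>n\<close> be the same iteration for the number
  \<open>B = 1\<close>; then \<open>a\<^sub>n\<close> increases to \<open>1\<close>. A positive root \<open>R\<close> of \<open>A\<close> makes \<open>Z = 1 - R\<close> a fixed
  point of the iteration, and writing \<open>Z\<^sup>2 - Y\<^sub>n\<^sup>2 = Z (Z - Y\<^sub>n) + (Z - Y\<^sub>n) Y\<^sub>n\<close> yields
  \<open>\<parallel>Z - Y\<^sub>n\<parallel> \<le> 1 - a\<^sub>n\<close> (\<open>op_root_sqrt_iter\<close>). This bound does not depend on \<open>A\<close>: it makes the root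
  unique, and it reduces strong continuity of the root to that of the
  operators \<open>Y\<^sub>n\<close>, which are polynomials in \<open>A\<close> (\<open>op_root_lim\<close>). The same identity shows that
  \<open>Y\<^sub>n f\<close> is a Cauchy sequence, so completeness of the space provides a root (\<open>op_root_exists\<close>).
\<close>

section \<open>The space of square-integrable functions\<close>

lemma L2_measurable [measurable_dest]: "f \<in> L2 M \<Longrightarrow> f \<in> borel_measurable M"
  and L2_integrable: "f \<in> L2 M \<Longrightarrow> integrable M (\<lambda>x. (norm (f x))\<^sup>2)"
  by (auto simp: L2_def)

lemma measurable_cnj [measurable]: "cnj \<in> borel_measurable borel"
  by (intro borel_measurable_continuous_onI continuous_intros)

lemma L2_zero: "(\<lambda>x. 0) \<in> L2 M"
  by (simp add: L2_def)

lemma L2_dominated: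
  assumes [measurable]: "f \<in> borel_measurable M"
    and g: "integrable M g" and le: "AE x in M. (norm (f x))\<^sup>2 \<le> g x"
  shows "f \<in> L2 M"
  unfolding L2_def mem_Collect_eq
proof (intro conjI)
  show "integrable M (\<lambda>x. (norm (f x))\<^sup>2)"
    by (rule Bochner_Integration.integrable_bound[OF g]) (use le in auto)
qed fact

lemma L2_add:
  assumes "f \<in> L2 M" "g \<in> L2 M"
  shows "(\<lambda>x. f x + g x) \<in> L2 M"
proof (rule L2_dominated)
  show "integrable M (\<lambda>x. 2 * (norm (f x))\<^sup>2 + 2 * (norm (g x))\<^sup>2)"
    using assms by (auto simp: L2_def)
  have "(norm (a + b))\<^sup>2 \<le> 2 * (norm a)\<^sup>2 + 2 * (norm b)\<^sup>2" for a b :: complex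
  proof -
    have "(norm (a + b))\<^sup>2 \<le> (norm a + norm b)\<^sup>2"
      by (simp add: norm_triangle_ineq power_mono)
    also have "\<dots> \<le> 2 * (norm a)\<^sup>2 + 2 * (norm b)\<^sup>2"
      using sum_squares_bound[of "norm a" "norm b"] by (simp add: power2_sum)
    finally show ?thesis .
  qed
  then show "AE x in M. (norm (f x + g x))\<^sup>2 \<le> 2 * (norm (f x))\<^sup>2 + 2 * (norm (g x))\<^sup>2"
    by simp
qed (use assms in measurable)

lemma L2_cmult: "f \<in> L2 M \<Longrightarrow> (\<lambda>x. c * f x) \<in> L2 M"
  by (auto simp: L2_def norm_mult power_mult_distrib)

lemma L2_diff:
  assumes "f \<in> L2 M" "g \<in> L2 M"
  shows "(\<lambda>x. f x - g x) \<in> L2 M"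
  using L2_add[OF assms(1) L2_cmult[OF assms(2), of "-1"]] by simp

lemma L2_divide: "f \<in> L2 M \<Longrightarrow> (\<lambda>x. f x / c) \<in> L2 M"
  using L2_cmult[of f M "inverse c"] by (simp add: divide_inverse mult.commute)

lemma L2_sum: "(\<And>i. i \<in> I \<Longrightarrow> f i \<in> L2 M) \<Longrightarrow> (\<lambda>x. \<Sum>i\<in>I. f i x) \<in> L2 M"
  by (induction I rule: infinite_finite_induct) (auto simp: L2_zero intro: L2_add)

lemma L2_prod_integrable:
  assumes "f \<in> L2 M" "g \<in> L2 M"
  shows "integrable M (\<lambda>x. cnj (f x) * g x)"
proof (rule Bochner_Integration.integrable_bound)
  show "integrable M (\<lambda>x. (norm (f x))\<^sup>2 + (norm (g x))\<^sup>2)"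
    using assms by (auto simp: L2_def)
  have "norm a * norm b \<le> (norm a)\<^sup>2 + (norm b)\<^sup>2" for a b :: complex
    using sum_squares_bound[of "norm a" "norm b"] mult_nonneg_nonneg[OF norm_ge_zero norm_ge_zero, of a b]
    unfolding mult.assoc by linarith
  then show "AE x in M. norm (cnj (f x) * g x) \<le> norm ((norm (f x))\<^sup>2 + (norm (g x))\<^sup>2)"
    by (simp add: norm_mult)
qed (use assms in measurable)

lemmas L2_closed = L2_zero L2_add L2_cmult L2_diff L2_divide L2_sum

lemma L2_inner_add_right:
  "f \<in> L2 M \<Longrightarrow> g \<in> L2 M \<Longrightarrow> h \<in> L2 M \<Longrightarrow>
    L2_inner M f (\<lambda>x. g x + h x) = L2_inner M f g + L2_inner M f h"
  by (simp add: L2_inner_def distrib_left L2_prod_integrable)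

lemma L2_inner_diff_right:
  "f \<in> L2 M \<Longrightarrow> g \<in> L2 M \<Longrightarrow> h \<in> L2 M \<Longrightarrow>
    L2_inner M f (\<lambda>x. g x - h x) = L2_inner M f g - L2_inner M f h"
  by (simp add: L2_inner_def right_diff_distrib L2_prod_integrable)

lemma L2_inner_cmult_right: "L2_inner M f (\<lambda>x. c * g x) = c * L2_inner M f g"
proof -
  have "L2_inner M f (\<lambda>x. c * g x) = (\<integral>x. c * (cnj (f x) * g x) \<partial>M)"
    by (simp add: L2_inner_def mult_ac)
  then show ?thesis by (simp add: L2_inner_def)
qed

lemma L2_inner_commute: "L2_inner M f g = cnj (L2_inner M g f)"
proof -
  have "L2_inner M f g = (\<integral>x. cnj (cnj (g x) * f x) \<partial>M)"
    by (simp add: L2_inner_def mult.commute)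
  then show ?thesis by (simp only: L2_inner_def Bochner_Integration.integral_cnj)
qed

lemma L2_inner_add_left:
  "f \<in> L2 M \<Longrightarrow> g \<in> L2 M \<Longrightarrow> h \<in> L2 M \<Longrightarrow>
    L2_inner M (\<lambda>x. g x + h x) f = L2_inner M g f + L2_inner M h f"
  by (subst (1 2 3) L2_inner_commute) (simp add: L2_inner_add_right)

lemma L2_inner_diff_left:
  "f \<in> L2 M \<Longrightarrow> g \<in> L2 M \<Longrightarrow> h \<in> L2 M \<Longrightarrow>
    L2_inner M (\<lambda>x. g x - h x) f = L2_inner M g f - L2_inner M h f"
  by (subst (1 2 3) L2_inner_commute) (simp add: L2_inner_diff_right)

lemma L2_inner_cmult_left: "L2_inner M (\<lambda>x. c * g x) f = cnj c * L2_inner M g f"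
  by (subst (1 2) L2_inner_commute) (simp add: L2_inner_cmult_right)

lemma L2_inner_sum_right:
  "f \<in> L2 M \<Longrightarrow> (\<And>i. i \<in> I \<Longrightarrow> g i \<in> L2 M) \<Longrightarrow>
    L2_inner M f (\<lambda>x. \<Sum>i\<in>I. g i x) = (\<Sum>i\<in>I. L2_inner M f (g i))"
  by (simp add: L2_inner_def sum_distrib_left L2_prod_integrable Bochner_Integration.integral_sum)

lemma L2_inner_cong_ae:
  assumes "f \<in> L2 M" "f' \<in> L2 M" "g \<in> L2 M" "g' \<in> L2 M" "ae_eq M f f'" "ae_eq M g g'"
  shows "L2_inner M f g = L2_inner M f' g'"
  unfolding L2_inner_def
proof (rule integral_cong_AE)
  show "AE x in M. cnj (f x) * g x = cnj (f' x) * g' x"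
    using assms(5,6) by (auto simp: ae_eq_def)
qed (use assms(1-4) in \<open>auto dest!: L2_measurable\<close>)

lemma L2_norm_nonneg: "0 \<le> L2_norm M f"
  by (simp add: L2_norm_def)

lemma L2_norm_square: "(L2_norm M f)\<^sup>2 = (\<integral>x. (norm (f x))\<^sup>2 \<partial>M)"
  by (simp add: L2_norm_def)

lemma L2_inner_self: "L2_inner M f f = of_real ((L2_norm M f)\<^sup>2)"
proof -
  have "L2_inner M f f = (\<integral>x. of_real ((norm (f x))\<^sup>2) \<partial>M)"
    unfolding L2_inner_def
    by (rule Bochner_Integration.integral_cong)
       (auto simp: complex_norm_square mult.commute simp del: of_real_power)
  then show ?thesis by (simp only: L2_norm_square integral_complex_of_real)
qed

lemma L2_norm_cong_ae:
  assumes "f \<in> L2 M" "f' \<in> L2 M" "ae_eq M f f'"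
  shows "L2_norm M f = L2_norm M f'"
  unfolding L2_norm_def
  by (intro arg_cong[where f=sqrt] integral_cong_AE)
     (use assms in \<open>auto simp: ae_eq_def dest!: L2_measurable\<close>)

lemma L2_norm_zero_iff:
  assumes "f \<in> L2 M"
  shows "L2_norm M f = 0 \<longleftrightarrow> (AE x in M. f x = 0)"
  using integral_nonneg_eq_0_iff_AE[OF L2_integrable[OF assms]]
  by (simp add: L2_norm_def)

lemma ae_eq_iff_norm:
  assumes "f \<in> L2 M" "g \<in> L2 M"
  shows "ae_eq M f g \<longleftrightarrow> L2_norm M (\<lambda>x. f x - g x) = 0"
  by (simp add: ae_eq_def L2_norm_zero_iff[OF L2_diff[OF assms]])

lemma L2_norm_cmult: "L2_norm M (\<lambda>x. c * f x) = norm c * L2_norm M f"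
  by (simp add: L2_norm_def norm_mult power_mult_distrib real_sqrt_mult)

lemma L2_norm_minus_commute: "L2_norm M (\<lambda>x. f x - g x) = L2_norm M (\<lambda>x. g x - f x)"
  by (simp add: L2_norm_def norm_minus_commute)

text \<open>
  After scaling both functions to norm one, this is the integrated inequality of arithmetic and
  geometric means; the case of a null function has to be treated apart.
\<close>

lemma L2_inner_bound:
  assumes f: "f \<in> L2 M" and g: "g \<in> L2 M"
  shows "norm (L2_inner M f g) \<le> L2_norm M f * L2_norm M g"
proof (cases "L2_norm M f = 0 \<or> L2_norm M g = 0")
  case True
  then have "AE x in M. cnj (f x) * g x = 0"
    using L2_norm_zero_iff[OF f] L2_norm_zero_iff[OF g] by auto
  then have "L2_inner M f g = 0"
    unfolding L2_inner_def by (rule integral_eq_zero_AE)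
  then show ?thesis by (simp add: L2_norm_nonneg)
next
  case False
  define a b where "a = L2_norm M f" and "b = L2_norm M g"
  have ab: "a > 0" "b > 0"
    using False L2_norm_nonneg[of M f] L2_norm_nonneg[of M g] by (auto simp: a_def b_def)
  have [simp]: "integrable M (\<lambda>x. (norm (f x))\<^sup>2)" "integrable M (\<lambda>x. (norm (g x))\<^sup>2)"
    using f g by (auto intro: L2_integrable)
  have ptw: "norm (cnj u * v) \<le> (b / (2 * a)) * (norm u)\<^sup>2 + (a / (2 * b)) * (norm v)\<^sup>2"
    for u v :: complex
  proof -
    have "0 \<le> (b * norm u - a * norm v)\<^sup>2 / (2 * a * b)"
      using ab by simp
    also have "\<dots> = (b / (2 * a)) * (norm u)\<^sup>2 + (a / (2 * b)) * (norm v)\<^sup>2 - norm u * norm v"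
      using ab by (simp add: power2_diff field_simps power2_eq_square)
    finally show ?thesis by (simp add: norm_mult)
  qed
  have "norm (L2_inner M f g) \<le> (\<integral>x. norm (cnj (f x) * g x) \<partial>M)"
    unfolding L2_inner_def by (rule integral_norm_bound)
  also have "\<dots> \<le> (\<integral>x. (b / (2 * a)) * (norm (f x))\<^sup>2 + (a / (2 * b)) * (norm (g x))\<^sup>2 \<partial>M)"
    using L2_prod_integrable[OF f g] ptw by (intro integral_mono integrable_norm) auto
  also have "\<dots> = (b / (2 * a)) * a\<^sup>2 + (a / (2 * b)) * b\<^sup>2"
    by (simp add: a_def b_def L2_norm_square)
  also have "\<dots> = a * b"
    using ab by (simp add: field_simps power2_eq_square)
  finally show ?thesis by (simp add: a_def b_def)
qed

lemma Re_L2_inner_le: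
  "f \<in> L2 M \<Longrightarrow> g \<in> L2 M \<Longrightarrow> Re (L2_inner M f g) \<le> L2_norm M f * L2_norm M g"
  using L2_inner_bound complex_Re_le_cmod order_trans by blast

lemma L2_norm_triangle:
  assumes f: "f \<in> L2 M" and g: "g \<in> L2 M"
  shows "L2_norm M (\<lambda>x. f x + g x) \<le> L2_norm M f + L2_norm M g"
proof (rule power2_le_imp_le)
  have "complex_of_real ((L2_norm M (\<lambda>x. f x + g x))\<^sup>2)
      = of_real ((L2_norm M f)\<^sup>2 + (L2_norm M g)\<^sup>2) + (L2_inner M f g + cnj (L2_inner M f g))"
    unfolding L2_inner_self[symmetric] of_real_add
    by (simp add: f g L2_inner_add_left L2_inner_add_right L2_add L2_inner_commute[of M g f])
  then have "(L2_norm M (\<lambda>x. f x + g x))\<^sup>2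
      = (L2_norm M f)\<^sup>2 + (L2_norm M g)\<^sup>2 + 2 * Re (L2_inner M f g)"
    unfolding complex_add_cnj of_real_add[symmetric] of_real_eq_iff by simp
  also have "Re (L2_inner M f g) \<le> L2_norm M f * L2_norm M g"
    by (rule Re_L2_inner_le[OF f g])
  finally show "(L2_norm M (\<lambda>x. f x + g x))\<^sup>2 \<le> (L2_norm M f + L2_norm M g)\<^sup>2"
    by (simp add: power2_sum)
qed (simp add: L2_norm_nonneg add_nonneg_nonneg)

lemma L2_norm_triangle_diff:
  assumes "f \<in> L2 M" "g \<in> L2 M" "h \<in> L2 M"
  shows "L2_norm M (\<lambda>x. f x - h x) \<le> L2_norm M (\<lambda>x. f x - g x) + L2_norm M (\<lambda>x. g x - h x)"
  using L2_norm_triangle[OF L2_diff[OF assms(1,2)] L2_diff[OF assms(2,3)]] by simp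

lemma L2_norm_sum_le:
  "(\<And>i. i \<in> I \<Longrightarrow> f i \<in> L2 M) \<Longrightarrow>
    L2_norm M (\<lambda>x. \<Sum>i\<in>I. f i x) \<le> (\<Sum>i\<in>I. L2_norm M (f i))"
proof (induction I rule: infinite_finite_induct)
  case (insert i I)
  then show ?case
    using L2_norm_triangle[of "f i" M "\<lambda>x. \<Sum>i\<in>I. f i x"] by (fastforce intro: L2_sum)
qed (simp_all add: L2_norm_def)

section \<open>Convergence in mean square and completeness\<close>

text \<open>
  Convergence in norm of representatives; limits are unique only up to null sets. Membership is part
  of the notion because \<open>L2_norm\<close> of a function that is not square integrable is a default value.
\<close>

definition L2_lim :: "'x measure \<Rightarrow> (nat \<Rightarrow> 'x \<Rightarrow> complex) \<Rightarrow> ('x \<Rightarrow> complex) \<Rightarrow> bool" where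
  "L2_lim M X F \<longleftrightarrow> (\<forall>n. X n \<in> L2 M) \<and> F \<in> L2 M \<and>
     (\<lambda>n. L2_norm M (\<lambda>x. X n x - F x)) \<longlonglongrightarrow> 0"

lemma L2_lim_squeeze:
  assumes "\<And>n. X n \<in> L2 M" "F \<in> L2 M"
    and "\<And>n. L2_norm M (\<lambda>x. X n x - F x) \<le> r n" "r \<longlonglongrightarrow> 0"
  shows "L2_lim M X F"
  unfolding L2_lim_def
  by (intro conjI allI assms(1,2) tendsto_sandwich[OF _ _ tendsto_const assms(4)])
     (auto simp: assms(3) L2_norm_nonneg)

lemma L2_limD:
  assumes "L2_lim M X F"
  shows "X n \<in> L2 M" "F \<in> L2 M" "(\<lambda>n. L2_norm M (\<lambda>x. X n x - F x)) \<longlonglongrightarrow> 0"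
  using assms by (auto simp: L2_lim_def)

lemma L2_lim_const: "F \<in> L2 M \<Longrightarrow> L2_lim M (\<lambda>n. F) F"
  by (simp add: L2_lim_def L2_norm_def)

lemma L2_lim_add:
  assumes "L2_lim M X F" "L2_lim M Y G"
  shows "L2_lim M (\<lambda>n x. X n x + Y n x) (\<lambda>x. F x + G x)"
proof (rule L2_lim_squeeze)
  note mem = L2_limD(1,2)[OF assms(1)] L2_limD(1,2)[OF assms(2)]
  show "L2_norm M (\<lambda>x. X n x + Y n x - (F x + G x))
      \<le> L2_norm M (\<lambda>x. X n x - F x) + L2_norm M (\<lambda>x. Y n x - G x)" for n
    using L2_norm_triangle[OF L2_diff L2_diff, OF mem(1,2) mem(3,4), of n n]
    by (simp add: algebra_simps)
  show "(\<lambda>n. L2_norm M (\<lambda>x. X n x - F x) + L2_norm M (\<lambda>x. Y n x - G x)) \<longlonglongrightarrow> 0"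
    using tendsto_add[OF L2_limD(3)[OF assms(1)] L2_limD(3)[OF assms(2)]] by simp
qed (use assms in \<open>auto intro!: L2_add dest: L2_limD\<close>)

lemma L2_lim_cmult:
  assumes "L2_lim M X F"
  shows "L2_lim M (\<lambda>n x. c * X n x) (\<lambda>x. c * F x)"
proof -
  have "(\<lambda>x. c * X n x - c * F x) = (\<lambda>x. c * (X n x - F x))" for n
    by (simp add: right_diff_distrib)
  then show ?thesis
    using assms by (auto simp: L2_lim_def L2_norm_cmult intro: L2_cmult tendsto_mult_right_zero)
qed

lemma L2_lim_diff:
  assumes "L2_lim M X F" "L2_lim M Y G"
  shows "L2_lim M (\<lambda>n x. X n x - Y n x) (\<lambda>x. F x - G x)"
  using L2_lim_add[OF assms(1) L2_lim_cmult[OF assms(2), of "-1"]] by simp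

lemma L2_lim_unique:
  assumes "L2_lim M X F" "L2_lim M X G"
  shows "ae_eq M F G"
proof -
  have "L2_lim M (\<lambda>n x. 0) (\<lambda>x. G x - F x)"
    using L2_lim_diff[OF assms(2,1)] by simp
  then have "(\<lambda>n::nat. L2_norm M (\<lambda>x. F x - G x)) \<longlonglongrightarrow> 0"
    using L2_norm_minus_commute[of M F G] by (auto simp: L2_lim_def)
  then have "L2_norm M (\<lambda>x. F x - G x) = 0"
    by (rule LIMSEQ_const_iff[THEN iffD1])
  then show ?thesis
    using assms by (subst ae_eq_iff_norm) (auto dest: L2_limD)
qed

lemma L2_lim_norm:
  assumes "L2_lim M X F"
  shows "(\<lambda>n. L2_norm M (X n)) \<longlonglongrightarrow> L2_norm M F"
proof -
  have "\<bar>L2_norm M (X n) - L2_norm M F\<bar> \<le> L2_norm M (\<lambda>x. X n x - F x)" for n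
    using L2_norm_triangle[OF L2_diff[OF L2_limD(1,2)[OF assms]] L2_limD(2)[OF assms], of n]
      L2_norm_triangle[OF L2_diff[OF L2_limD(2,1)[OF assms]] L2_limD(1)[OF assms], of n n]
      L2_norm_minus_commute[of M F "X n"] by auto
  then have "(\<lambda>n. L2_norm M (X n) - L2_norm M F) \<longlonglongrightarrow> 0"
    by (intro Lim_null_comparison[OF _ L2_limD(3)[OF assms]]) simp
  then show ?thesis by (simp add: LIM_zero_iff)
qed

lemma L2_lim_inner:
  assumes "L2_lim M X F" "L2_lim M Y G"
  shows "(\<lambda>n. L2_inner M (X n) (Y n)) \<longlonglongrightarrow> L2_inner M F G"
proof -
  note mem = L2_limD(1,2)[OF assms(1)] L2_limD(1,2)[OF assms(2)]
  let ?r = "\<lambda>n. L2_norm M (\<lambda>x. X n x - F x) * L2_norm M (Y n)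
    + L2_norm M F * L2_norm M (\<lambda>x. Y n x - G x)"
  have le: "norm (L2_inner M (X n) (Y n) - L2_inner M F G) \<le> ?r n" for n
  proof -
    have "L2_inner M (X n) (Y n) - L2_inner M F G
        = L2_inner M (\<lambda>x. X n x - F x) (Y n) + L2_inner M F (\<lambda>x. Y n x - G x)"
      using mem by (simp add: L2_inner_diff_left L2_inner_diff_right)
    also have "norm \<dots> \<le> ?r n"
      using mem by (intro norm_triangle_mono L2_inner_bound L2_diff)
    finally show ?thesis .
  qed
  have "?r \<longlonglongrightarrow> 0"
    using tendsto_add[OF tendsto_mult[OF L2_limD(3)[OF assms(1)] L2_lim_norm[OF assms(2)]]
        tendsto_mult[OF tendsto_const L2_limD(3)[OF assms(2)]], of "L2_norm M F"] by simp
  then have "(\<lambda>n. L2_inner M (X n) (Y n) - L2_inner M F G) \<longlonglongrightarrow> 0"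
    by (rule Lim_null_comparison[OF always_eventually[OF allI[OF le]]])
  then show ?thesis by (simp add: LIM_zero_iff)
qed

lemma L2_lim_cong:
  assumes "L2_lim M X F" "\<And>n. X' n \<in> L2 M" "\<And>n. ae_eq M (X n) (X' n)"
  shows "L2_lim M X' F"
proof (rule L2_lim_squeeze[OF assms(2) L2_limD(2)[OF assms(1)] _ L2_limD(3)[OF assms(1)]])
  fix n
  have "L2_norm M (\<lambda>x. X' n x - F x) = L2_norm M (\<lambda>x. X n x - F x)"
    using assms(3)[of n]
    by (intro L2_norm_cong_ae L2_diff assms(2) L2_limD[OF assms(1)])
       (auto simp: ae_eq_def elim: eventually_mono)
  then show "L2_norm M (\<lambda>x. X' n x - F x) \<le> L2_norm M (\<lambda>x. X n x - F x)" by simp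
qed

text \<open>
  Riesz--Fischer, in the form that an absolutely convergent series converges. The partial sums of the
  absolute values increase and have bounded norms, so by monotone convergence their squares are
  bounded almost everywhere by an integrable function. Hence the series converges almost everywhere,
  and that function dominates the squared errors.
\<close>

lemma L2_complete:
  assumes d: "\<And>k. d k \<in> L2 M" and sm: "summable (\<lambda>k. L2_norm M (d k))"
  shows "\<exists>F. L2_lim M (\<lambda>n x. \<Sum>k<n. d k x) F"
proof -
  have [measurable]: "d k \<in> borel_measurable M" for k
    using d by (rule L2_measurable)
  define C where "C = (\<Sum>k. L2_norm M (d k))"
  define g where "g n x = (\<Sum>k<n. norm (d k x))" for n x
  have g_meas [measurable]: "g n \<in> borel_measurable M" for n
    unfolding g_def by measurable
  have g0: "0 \<le> g n x" for n x by (simp add: g_def sum_nonneg)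
  have g_mono: "g m x \<le> g n x" if "m \<le> n" for m n x
    unfolding g_def using that by (intro sum_mono2) auto
  have g_L2: "(\<lambda>x. complex_of_real (g n x)) \<in> L2 M"
    and g_norm: "L2_norm M (\<lambda>x. complex_of_real (g n x)) \<le> C" for n
  proof -
    have abs: "(\<lambda>x. complex_of_real (norm (d k x))) \<in> L2 M"
      "L2_norm M (\<lambda>x. complex_of_real (norm (d k x))) = L2_norm M (d k)" for k
      using L2_integrable[OF d] by (auto simp: L2_def L2_norm_def)
    show "(\<lambda>x. complex_of_real (g n x)) \<in> L2 M"
      unfolding g_def of_real_sum by (intro L2_sum abs)
    have "L2_norm M (\<lambda>x. complex_of_real (g n x)) \<le> (\<Sum>k<n. L2_norm M (d k))"
      unfolding g_def of_real_sum
      using L2_norm_sum_le[of "{..<n}" "\<lambda>k x. complex_of_real (norm (d k x))" M] abs by simp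
    also have "\<dots> \<le> C"
      unfolding C_def by (intro sum_le_suminf sm) (auto simp: L2_norm_nonneg)
    finally show "L2_norm M (\<lambda>x. complex_of_real (g n x)) \<le> C" .
  qed
  define G where "G x = (SUP n. ennreal ((g n x)\<^sup>2))" for x
  have G_meas [measurable]: "G \<in> borel_measurable M"
    unfolding G_def by measurable
  have "(\<integral>\<^sup>+x. G x \<partial>M) = (SUP n. \<integral>\<^sup>+x. ennreal ((g n x)\<^sup>2) \<partial>M)"
    unfolding G_def
    by (rule nn_integral_monotone_convergence_SUP)
       (auto simp: incseq_def le_fun_def intro!: ennreal_leI power_mono g_mono g0)
  also have "\<dots> \<le> ennreal (C\<^sup>2)"
  proof (rule SUP_least)
    fix n
    have "(\<integral>\<^sup>+x. ennreal ((g n x)\<^sup>2) \<partial>M) = ennreal ((L2_norm M (\<lambda>x. complex_of_real (g n x)))\<^sup>2)"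
      using L2_integrable[OF g_L2, of n] unfolding L2_norm_square
      by (subst nn_integral_eq_integral) auto
    also have "\<dots> \<le> ennreal (C\<^sup>2)"
      by (intro ennreal_leI power_mono g_norm L2_norm_nonneg)
    finally show "(\<integral>\<^sup>+x. ennreal ((g n x)\<^sup>2) \<partial>M) \<le> ennreal (C\<^sup>2)" .
  qed
  finally have G_fin: "(\<integral>\<^sup>+x. G x \<partial>M) < \<infinity>"
    by (simp add: le_less_trans)
  then have G_ae: "AE x in M. G x \<noteq> \<infinity>"
    by (intro nn_integral_PInf_AE) auto
  \<comment> \<open>\<open>G\<close> may be infinite on a null set, where \<open>W\<close> takes the value \<open>0\<close>.\<close>
  define W where "W x = enn2real (G x)" for x
  have [measurable]: "W \<in> borel_measurable M" unfolding W_def by measurable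
  have W0: "0 \<le> W x" for x by (simp add: W_def)
  have W_int: "integrable M W"
  proof (rule integrableI_nonneg)
    have "(\<integral>\<^sup>+x. ennreal (W x) \<partial>M) = (\<integral>\<^sup>+x. G x \<partial>M)"
      using G_ae by (intro nn_integral_cong_AE) (auto simp: W_def top.not_eq_extremum)
    then show "(\<integral>\<^sup>+x. ennreal (W x) \<partial>M) < \<infinity>" using G_fin by simp
  qed (auto simp: W0)
  have gW: "AE x in M. \<forall>n. (g n x)\<^sup>2 \<le> W x"
    using G_ae
  proof eventually_elim
    case (elim x)
    then have "ennreal (W x) = G x" by (simp add: W_def top.not_eq_extremum)
    then have "ennreal ((g n x)\<^sup>2) \<le> ennreal (W x)" for n
      unfolding G_def by (auto intro: SUP_upper)
    then show ?case using W0 by (simp add: ennreal_le_iff)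
  qed
  define F where "F x = (\<Sum>k. d k x)" for x
  have [measurable]: "F \<in> borel_measurable M" unfolding F_def by measurable
  define S where "S n x = (\<Sum>k<n. d k x)" for n x
  have [measurable]: "S n \<in> borel_measurable M" for n unfolding S_def by measurable
  have SF: "AE x in M. (\<lambda>n. S n x) \<longlonglongrightarrow> F x"
    using gW
  proof eventually_elim
    case (elim x)
    have "g n x \<le> sqrt (W x)" for n using elim by (simp add: real_le_rsqrt)
    then have "summable (\<lambda>k. norm (d k x))"
      by (intro summableI_nonneg_bounded) (auto simp: g_def)
    then have "summable (\<lambda>k. d k x)" by (rule summable_norm_cancel)
    then show ?case unfolding S_def F_def by (rule summable_LIMSEQ)
  qed
  have SW: "AE x in M. \<forall>n. (norm (S n x))\<^sup>2 \<le> W x"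
    using gW
  proof eventually_elim
    case (elim x)
    have "norm (S n x) \<le> g n x" for n unfolding S_def g_def by (rule norm_sum)
    then show ?case using elim by (meson norm_ge_zero power_mono order_trans)
  qed
  have FW: "AE x in M. (norm (F x))\<^sup>2 \<le> W x"
    using SF SW
  proof eventually_elim
    case (elim x)
    then have "(\<lambda>n. (norm (S n x))\<^sup>2) \<longlonglongrightarrow> (norm (F x))\<^sup>2" by (intro tendsto_intros)
    then show ?case using elim by (intro LIMSEQ_le_const2) auto
  qed
  have F_L2: "F \<in> L2 M" by (rule L2_dominated[OF _ W_int FW]) measurable
  have "(\<lambda>n. \<integral>x. (norm (S n x - F x))\<^sup>2 \<partial>M) \<longlonglongrightarrow> (\<integral>x. 0 \<partial>M)"
  proof (rule integral_dominated_convergence)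
    show "integrable M (\<lambda>x. 4 * W x)" using W_int by simp
    show "AE x in M. (\<lambda>n. (norm (S n x - F x))\<^sup>2) \<longlonglongrightarrow> 0"
      using SF
    proof eventually_elim
      case (elim x)
      then have "(\<lambda>n. (norm (S n x - F x))\<^sup>2) \<longlonglongrightarrow> (norm (F x - F x))\<^sup>2"
        by (intro tendsto_intros)
      then show ?case by simp
    qed
    fix n
    show "AE x in M. norm ((norm (S n x - F x))\<^sup>2) \<le> 4 * W x"
      using SW FW
    proof eventually_elim
      case (elim x)
      have "norm (S n x - F x) \<le> sqrt (W x) + sqrt (W x)"
        using elim by (intro norm_triangle_le_diff add_mono real_le_rsqrt) auto
      then have "(norm (S n x - F x))\<^sup>2 \<le> (2 * sqrt (W x))\<^sup>2"
        by (intro power_mono) auto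
      then show ?case by (simp add: W0 power_mult_distrib)
    qed
  qed measurable
  then have "(\<lambda>n. L2_norm M (\<lambda>x. S n x - F x)) \<longlonglongrightarrow> sqrt 0"
    unfolding L2_norm_def by (intro tendsto_real_sqrt) simp
  moreover have "S n \<in> L2 M" for n unfolding S_def by (intro L2_sum d)
  ultimately have "L2_lim M S F" using F_L2 by (simp add: L2_lim_def)
  then show ?thesis unfolding S_def by blast
qed

section \<open>Bounded and positive operators\<close>

lemma bounded_op_L2: "bounded_op M A \<Longrightarrow> f \<in> L2 M \<Longrightarrow> A f \<in> L2 M"
  and bounded_op_cong: "bounded_op M A \<Longrightarrow> f \<in> L2 M \<Longrightarrow> g \<in> L2 M \<Longrightarrow> ae_eq M f g \<Longrightarrow>
    ae_eq M (A f) (A g)"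
  and bounded_op_add: "bounded_op M A \<Longrightarrow> f \<in> L2 M \<Longrightarrow> g \<in> L2 M \<Longrightarrow>
    ae_eq M (A (\<lambda>x. f x + g x)) (\<lambda>x. A f x + A g x)"
  and bounded_op_cmult: "bounded_op M A \<Longrightarrow> f \<in> L2 M \<Longrightarrow>
    ae_eq M (A (\<lambda>x. c * f x)) (\<lambda>x. c * A f x)"
  by (auto simp: bounded_op_def)

lemma ae_eq_refl: "ae_eq M f f"
  and ae_eq_sym: "ae_eq M f g \<Longrightarrow> ae_eq M g f"
  and ae_eq_trans: "ae_eq M f g \<Longrightarrow> ae_eq M g h \<Longrightarrow> ae_eq M f h"
  by (auto simp: ae_eq_def elim: eventually_elim2)

lemma bounded_op_diff:
  assumes "bounded_op M A" "f \<in> L2 M" "g \<in> L2 M"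
  shows "ae_eq M (A (\<lambda>x. f x - g x)) (\<lambda>x. A f x - A g x)"
  using bounded_op_add[OF assms(1,2) L2_cmult[OF assms(3), of "-1"]]
    bounded_op_cmult[OF assms(1,3), of "-1"]
  by (auto simp: ae_eq_def elim: eventually_elim2)

lemma bounded_op_bound:
  assumes "bounded_op M A"
  obtains C where "0 \<le> C" "\<And>f. f \<in> L2 M \<Longrightarrow> L2_norm M (A f) \<le> C * L2_norm M f"
proof -
  obtain C where C: "L2_norm M (A f) \<le> C * L2_norm M f" if "f \<in> L2 M" for f
    using assms unfolding bounded_op_def by metis
  have "L2_norm M (A f) \<le> \<bar>C\<bar> * L2_norm M f" if "f \<in> L2 M" for f
    using C[OF that] by (rule order_trans) (auto intro: mult_right_mono L2_norm_nonneg)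
  then show ?thesis by (intro that[of "\<bar>C\<bar>"]) auto
qed

lemma bounded_opI:
  assumes "\<And>f. f \<in> L2 M \<Longrightarrow> A f \<in> L2 M"
    and "\<And>f g. f \<in> L2 M \<Longrightarrow> g \<in> L2 M \<Longrightarrow> ae_eq M f g \<Longrightarrow> ae_eq M (A f) (A g)"
    and "\<And>f g. f \<in> L2 M \<Longrightarrow> g \<in> L2 M \<Longrightarrow> ae_eq M (A (\<lambda>x. f x + g x)) (\<lambda>x. A f x + A g x)"
    and "\<And>f c. f \<in> L2 M \<Longrightarrow> ae_eq M (A (\<lambda>x. c * f x)) (\<lambda>x. c * A f x)"
    and "\<And>f. f \<in> L2 M \<Longrightarrow> L2_norm M (A f) \<le> C * L2_norm M f"
  shows "bounded_op M A"
  unfolding bounded_op_def using assms by (intro conjI exI[of _ C]) auto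

lemma bounded_op_id: "bounded_op M (\<lambda>f. f)"
  by (rule bounded_opI[where C=1]) (auto simp: ae_eq_refl)

lemma bounded_op_zero: "bounded_op M (\<lambda>f x. 0)"
  by (rule bounded_opI[where C=0]) (auto simp: ae_eq_refl L2_zero L2_norm_def)

lemma bounded_op_comp:
  assumes A: "bounded_op M A" and B: "bounded_op M B"
  shows "bounded_op M (\<lambda>f. A (B f))"
proof -
  obtain a where a: "0 \<le> a" "\<And>f. f \<in> L2 M \<Longrightarrow> L2_norm M (A f) \<le> a * L2_norm M f"
    using bounded_op_bound[OF A] by blast
  obtain b where b: "0 \<le> b" "\<And>f. f \<in> L2 M \<Longrightarrow> L2_norm M (B f) \<le> b * L2_norm M f"
    using bounded_op_bound[OF B] by blast
  note mem = bounded_op_L2[OF A] bounded_op_L2[OF B]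
  show ?thesis
  proof (rule bounded_opI)
    fix f g :: "'a \<Rightarrow> complex" and c assume f: "f \<in> L2 M" 
    show "ae_eq M (A (B (\<lambda>x. c * f x))) (\<lambda>x. c * A (B f) x)"
      using bounded_op_cong[OF A _ _ bounded_op_cmult[OF B f]] bounded_op_cmult[OF A mem(2)[OF f]]
      by (rule ae_eq_trans) (auto intro: mem f L2_cmult)
    show "L2_norm M (A (B f)) \<le> (a * b) * L2_norm M f"
      using a(2)[OF mem(2)[OF f]] mult_left_mono[OF b(2)[OF f] a(1)] by simp
    assume g: "g \<in> L2 M"
    show "ae_eq M (A (B (\<lambda>x. f x + g x))) (\<lambda>x. A (B f) x + A (B g) x)"
      using bounded_op_cong[OF A _ _ bounded_op_add[OF B f g]]
        bounded_op_add[OF A mem(2)[OF f] mem(2)[OF g]]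
      by (rule ae_eq_trans) (auto intro: mem f g L2_add)
  qed (auto intro: mem bounded_op_cong[OF A] bounded_op_cong[OF B])
qed

lemma bounded_op_plus:
  assumes A: "bounded_op M A" and B: "bounded_op M B"
  shows "bounded_op M (\<lambda>f x. A f x + B f x)"
proof -
  obtain a where a: "0 \<le> a" "\<And>f. f \<in> L2 M \<Longrightarrow> L2_norm M (A f) \<le> a * L2_norm M f"
    using bounded_op_bound[OF A] by blast
  obtain b where b: "0 \<le> b" "\<And>f. f \<in> L2 M \<Longrightarrow> L2_norm M (B f) \<le> b * L2_norm M f"
    using bounded_op_bound[OF B] by blast
  note mem = bounded_op_L2[OF A] bounded_op_L2[OF B]
  show ?thesis
  proof (rule bounded_opI)
    fix f g :: "'a \<Rightarrow> complex" and c assume f: "f \<in> L2 M" 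
    show "(\<lambda>x. A f x + B f x) \<in> L2 M" by (intro L2_add mem f)
    show "ae_eq M (\<lambda>x. A (\<lambda>x. c * f x) x + B (\<lambda>x. c * f x) x) (\<lambda>x. c * (A f x + B f x))"
      using bounded_op_cmult[OF A f, of c] bounded_op_cmult[OF B f, of c]
      by (auto simp: ae_eq_def distrib_left elim: eventually_elim2)
    show "L2_norm M (\<lambda>x. A f x + B f x) \<le> (a + b) * L2_norm M f"
      using L2_norm_triangle[OF mem(1,2), OF f f] a(2)[OF f] b(2)[OF f] by (simp add: distrib_right)
    assume g: "g \<in> L2 M"
    show "ae_eq M (\<lambda>x. A (\<lambda>x. f x + g x) x + B (\<lambda>x. f x + g x) x)
        (\<lambda>x. A f x + B f x + (A g x + B g x))"
      using bounded_op_add[OF A f g] bounded_op_add[OF B f g]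
      by (auto simp: ae_eq_def elim: eventually_elim2)
    assume "ae_eq M f g"
    then show "ae_eq M (\<lambda>x. A f x + B f x) (\<lambda>x. A g x + B g x)"
      using bounded_op_cong[OF A f g] bounded_op_cong[OF B f g]
      by (auto simp: ae_eq_def elim: eventually_elim2)
  qed
qed

lemma bounded_op_scale:
  assumes A: "bounded_op M A"
  shows "bounded_op M (\<lambda>f x. c * A f x)"
proof -
  obtain a where a: "0 \<le> a" "\<And>f. f \<in> L2 M \<Longrightarrow> L2_norm M (A f) \<le> a * L2_norm M f"
    using bounded_op_bound[OF A] by blast
  show ?thesis
  proof (rule bounded_opI)
    fix f g :: "'a \<Rightarrow> complex" and b assume f: "f \<in> L2 M" 
    show "(\<lambda>x. c * A f x) \<in> L2 M" by (intro L2_cmult bounded_op_L2[OF A] f)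
    show "ae_eq M (\<lambda>x. c * A (\<lambda>x. b * f x) x) (\<lambda>x. b * (c * A f x))"
      using bounded_op_cmult[OF A f, of b] by (auto simp: ae_eq_def elim: eventually_mono)
    show "L2_norm M (\<lambda>x. c * A f x) \<le> (norm c * a) * L2_norm M f"
      using a(2)[OF f] by (simp add: L2_norm_cmult mult_left_mono mult.assoc)
    assume g: "g \<in> L2 M"
    show "ae_eq M (\<lambda>x. c * A (\<lambda>x. f x + g x) x) (\<lambda>x. c * A f x + c * A g x)"
      using bounded_op_add[OF A f g] by (auto simp: ae_eq_def distrib_left elim: eventually_mono)
    assume "ae_eq M f g"
    then show "ae_eq M (\<lambda>x. c * A f x) (\<lambda>x. c * A g x)"
      using bounded_op_cong[OF A f g] by (auto simp: ae_eq_def elim: eventually_mono)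
  qed
qed

lemma bounded_op_minus:
  assumes "bounded_op M A" "bounded_op M B"
  shows "bounded_op M (\<lambda>f x. A f x - B f x)"
  using bounded_op_plus[OF assms(1) bounded_op_scale[OF assms(2), of "-1"]] by simp

lemma bounded_op_lim:
  assumes A: "bounded_op M A" and X: "L2_lim M X F"
  shows "L2_lim M (\<lambda>n. A (X n)) (A F)"
proof -
  obtain a where "0 \<le> a" and a: "\<And>f. f \<in> L2 M \<Longrightarrow> L2_norm M (A f) \<le> a * L2_norm M f"
    using bounded_op_bound[OF A] by blast
  note mem = L2_limD(1,2)[OF X]
  show ?thesis
  proof (rule L2_lim_squeeze)
    fix n
    have "L2_norm M (\<lambda>x. A (X n) x - A F x) = L2_norm M (A (\<lambda>x. X n x - F x))"
      by (intro L2_norm_cong_ae ae_eq_sym[OF bounded_op_diff[OF A]] L2_diff bounded_op_L2[OF A] mem)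
    also have "\<dots> \<le> a * L2_norm M (\<lambda>x. X n x - F x)"
      by (intro a L2_diff mem)
    finally show "L2_norm M (\<lambda>x. A (X n) x - A F x) \<le> a * L2_norm M (\<lambda>x. X n x - F x)" .
  qed (use L2_limD(3)[OF X] in \<open>auto intro: bounded_op_L2[OF A] mem tendsto_mult_right_zero\<close>)
qed

lemma positive_op_bounded: "positive_op M A \<Longrightarrow> bounded_op M A"
  by (simp add: positive_op_def)

lemma positive_op_inner_real:
  assumes "positive_op M A" "f \<in> L2 M"
  shows "L2_inner M f (A f) = of_real (Re (L2_inner M f (A f)))" "0 \<le> Re (L2_inner M f (A f))"
  using assms by (auto simp: positive_op_def complex_nonneg_Reals_iff complex_eq_iff)

text \<open>
  Polarization: over the complex numbers a form that is real on the diagonal is Hermitian, as seen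
  by comparing its values at \<open>f + g\<close> and \<open>f + \<i> g\<close>.
\<close>

lemma positive_op_symmetric:
  assumes A: "positive_op M A" and f: "f \<in> L2 M" and g: "g \<in> L2 M"
  shows "L2_inner M (A f) g = L2_inner M f (A g)"
proof -
  note b = positive_op_bounded[OF A]
  note mem = bounded_op_L2[OF b]
  have Im0: "Im (L2_inner M h (A h)) = 0" if "h \<in> L2 M" for h
    using A that by (auto simp: positive_op_def complex_nonneg_Reals_iff)
  \<comment> \<open>The imaginary part of the form at \<open>f + h\<close> is carried by the mixed terms.\<close>
  have cross: "Im (L2_inner M f (A h) + L2_inner M h (A f)) = 0" if h: "h \<in> L2 M" for h
  proof -
    have "L2_inner M (\<lambda>x. f x + h x) (A (\<lambda>x. f x + h x))
        = L2_inner M (\<lambda>x. f x + h x) (\<lambda>x. A f x + A h x)"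
      by (intro L2_inner_cong_ae bounded_op_add[OF b] ae_eq_refl L2_add mem f h)
    also have "\<dots> = L2_inner M f (A f) + L2_inner M h (A h)
        + (L2_inner M f (A h) + L2_inner M h (A f))"
      by (simp add: L2_inner_add_left L2_inner_add_right L2_add mem f h)
    finally show ?thesis
      using Im0[OF L2_add[OF f h]] Im0[OF f] Im0[OF h] by simp
  qed
  have "L2_inner M f (A (\<lambda>x. \<i> * g x)) = \<i> * L2_inner M f (A g)"
    unfolding L2_inner_cmult_right[symmetric]
    by (intro L2_inner_cong_ae bounded_op_cmult[OF b] ae_eq_refl L2_cmult mem f g)
  then have "Re (L2_inner M f (A g)) = Re (L2_inner M g (A f))"
    using cross[OF L2_cmult[OF g], of \<i>] by (simp add: L2_inner_cmult_left)
  moreover have "Im (L2_inner M f (A g)) = - Im (L2_inner M g (A f))"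
    using cross[OF g] by simp
  ultimately have "L2_inner M f (A g) = cnj (L2_inner M g (A f))"
    by (simp add: complex_eq_iff)
  then show ?thesis using L2_inner_commute[of M "A f" g] by simp
qed

definition effect_op :: "'x measure \<Rightarrow> 'x op \<Rightarrow> bool" where
  "effect_op M A \<longleftrightarrow> positive_op M A \<and> positive_op M (\<lambda>f x. f x - A f x)"

lemma effect_opI:
  assumes "positive_op M A"
    and "\<And>f. f \<in> L2 M \<Longrightarrow> Re (L2_inner M f (A f)) \<le> (L2_norm M f)\<^sup>2"
  shows "effect_op M A"
proof -
  note b = positive_op_bounded[OF assms(1)]
  have "L2_inner M f (\<lambda>x. f x - A f x) \<in> \<real>\<^sub>\<ge>\<^sub>0" if f: "f \<in> L2 M" for f
  proof -
    have "L2_inner M f (\<lambda>x. f x - A f x)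
        = of_real ((L2_norm M f)\<^sup>2 - Re (L2_inner M f (A f)))"
      using positive_op_inner_real(1)[OF assms(1) f]
      by (simp add: L2_inner_diff_right f bounded_op_L2[OF b] L2_inner_self)
    then show ?thesis using assms(2)[OF f] by (simp only: nonneg_Reals_of_real_iff)
  qed
  then show ?thesis
    using assms(1) by (auto simp: effect_op_def positive_op_def intro!: bounded_op_minus bounded_op_id)
qed

lemma effect_op_compl: "effect_op M A \<Longrightarrow> effect_op M (\<lambda>f x. f x - A f x)"
  by (simp add: effect_op_def)

lemma effect_op_bounded: "effect_op M A \<Longrightarrow> bounded_op M A"
  by (simp add: effect_op_def positive_op_def)

text \<open>
  Both bounds express \<open>A\<^sup>2 \<le> A \<le> 1\<close>. The first inequality is the positivity of
  \<open>A - A\<^sup>2 = A (1 - A) A + (1 - A) A (1 - A)\<close>, evaluated at \<open>f\<close> through \<open>u = A f\<close> and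
  \<open>v = (1 - A) f\<close>.
\<close>

lemma effect_op_contraction:
  assumes A: "effect_op M A" and f: "f \<in> L2 M"
  shows "(L2_norm M (A f))\<^sup>2 \<le> Re (L2_inner M f (A f))" "L2_norm M (A f) \<le> L2_norm M f"
proof -
  have pos: "positive_op M A" "positive_op M (\<lambda>f x. f x - A f x)"
    using A by (auto simp: effect_op_def)
  note b = positive_op_bounded[OF pos(1)]
  note mem = bounded_op_L2[OF b]
  define u where "u = A f"
  define v where "v = (\<lambda>x. f x - u x)"
  have u: "u \<in> L2 M" and v: "v \<in> L2 M" and Au: "A u \<in> L2 M"
    by (auto simp: u_def v_def intro!: L2_diff mem f)
  have Av: "L2_inner M v (A v) = L2_inner M v (\<lambda>x. u x - A u x)"
    using bounded_op_diff[OF b f u]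
    by (intro L2_inner_cong_ae ae_eq_refl mem v) (auto simp: v_def u_def intro: L2_diff mem f)
  have fAu: "L2_inner M f (A u) = L2_inner M u u"
    using positive_op_symmetric[OF pos(1) f u] by (simp add: u_def)
  have "L2_inner M u (\<lambda>x. u x - A u x) + L2_inner M v (A v) = L2_inner M f u - L2_inner M u u"
    unfolding Av unfolding v_def
    by (simp add: L2_inner_diff_left L2_inner_diff_right L2_diff f u Au fAu)
  moreover have "0 \<le> Re (L2_inner M u (\<lambda>x. u x - A u x))" "0 \<le> Re (L2_inner M v (A v))"
    using positive_op_inner_real(2)[OF pos(2) u] positive_op_inner_real(2)[OF pos(1) v] by auto
  ultimately have "0 \<le> Re (L2_inner M f u - L2_inner M u u)"
    by (metis add_nonneg_nonneg plus_complex.sel(1))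
  then show *: "(L2_norm M (A f))\<^sup>2 \<le> Re (L2_inner M f (A f))"
    by (simp add: L2_inner_self u_def)
  have "0 \<le> Re (L2_inner M f (\<lambda>x. f x - A f x))"
    using positive_op_inner_real(2)[OF pos(2) f] .
  then have "Re (L2_inner M f (A f)) \<le> (L2_norm M f)\<^sup>2"
    by (simp add: L2_inner_diff_right f mem L2_inner_self)
  with * show "L2_norm M (A f) \<le> L2_norm M f"
    by (intro power2_le_imp_le[OF _ L2_norm_nonneg]) linarith
qed

text \<open>
  Strong convergence of uniformly bounded operators also holds along a convergent sequence of
  arguments, as is needed when operator and vector are truncated simultaneously.
\<close>

lemma strong_lim_moving:
  assumes T: "\<And>n. bounded_op M (T n)"
    and C: "\<And>n f. f \<in> L2 M \<Longrightarrow> L2_norm M (T n f) \<le> C * L2_norm M f"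
    and lim: "L2_lim M (\<lambda>n. T n F) G" and X: "L2_lim M X F"
  shows "L2_lim M (\<lambda>n. T n (X n)) G"
proof -
  note mem = L2_limD(1,2)[OF X]
  have "L2_lim M (\<lambda>n. T n (\<lambda>x. X n x - F x)) (\<lambda>x. 0)"
  proof (rule L2_lim_squeeze)
    show "L2_norm M (\<lambda>x. T n (\<lambda>x. X n x - F x) x - 0) \<le> C * L2_norm M (\<lambda>x. X n x - F x)" for n
      using C[OF L2_diff[OF mem]] by simp
    show "(\<lambda>n. C * L2_norm M (\<lambda>x. X n x - F x)) \<longlonglongrightarrow> 0"
      using L2_limD(3)[OF X] by (rule tendsto_mult_right_zero)
  qed (intro bounded_op_L2[OF T] L2_closed mem)+
  from L2_lim_add[OF this lim]
  have "L2_lim M (\<lambda>n x. T n (\<lambda>x. X n x - F x) x + T n F x) G" by simp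
  then show ?thesis
  proof (rule L2_lim_cong)
    fix n
    show "T n (X n) \<in> L2 M" by (intro bounded_op_L2[OF T] mem)
    show "ae_eq M (\<lambda>x. T n (\<lambda>x. X n x - F x) x + T n F x) (T n (X n))"
      using bounded_op_diff[OF T mem, of n n] by (auto simp: ae_eq_def elim: eventually_mono)
  qed
qed

section \<open>Square roots of effects\<close>

primrec sqrt_scalar :: "nat \<Rightarrow> real" where
  "sqrt_scalar 0 = 0"
| "sqrt_scalar (Suc n) = (1 + (sqrt_scalar n)\<^sup>2) / 2"

text \<open>
  The approximations of \<open>1 - \<surd>(1 - B)\<close> obtained by iterating the fixed point equation
  \<open>Y = (B + Y\<^sup>2) / 2\<close>. The scalar iteration above is the case \<open>B = 1\<close>, and all norms are bounded by
  its terms and their differences.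
\<close>

primrec sqrt_iter :: "'x op \<Rightarrow> nat \<Rightarrow> 'x op" where
  "sqrt_iter B 0 = (\<lambda>f x. 0)"
| "sqrt_iter B (Suc n) = (\<lambda>f x. (1 / 2) * (B f x + sqrt_iter B n (sqrt_iter B n f) x))"

lemma sqrt_scalar_bounds: "0 \<le> sqrt_scalar n" "sqrt_scalar n \<le> 1"
proof -
  have "0 \<le> sqrt_scalar n \<and> sqrt_scalar n \<le> 1"
    by (induction n) (auto simp: power_le_one)
  then show "0 \<le> sqrt_scalar n" "sqrt_scalar n \<le> 1" by auto
qed

lemma sqrt_scalar_mono: "sqrt_scalar n \<le> sqrt_scalar (Suc n)"
  using zero_le_power2[of "1 - sqrt_scalar n"] by (simp add: power2_diff)

lemma sqrt_scalar_lim: "sqrt_scalar \<longlonglongrightarrow> 1"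
proof -
  have "incseq sqrt_scalar" by (rule incseq_SucI) (rule sqrt_scalar_mono)
  then obtain l where l: "sqrt_scalar \<longlonglongrightarrow> l"
    by (rule incseq_convergent[where B=1]) (auto simp: sqrt_scalar_bounds)
  have "(\<lambda>n. sqrt_scalar (Suc n)) \<longlonglongrightarrow> (1 + l\<^sup>2) / 2"
    unfolding sqrt_scalar.simps by (intro tendsto_intros l) simp
  then have "l = (1 + l\<^sup>2) / 2"
    using LIMSEQ_Suc[OF l] LIMSEQ_unique by blast
  then have "(1 - l)\<^sup>2 = 0" by (simp add: power2_diff)
  then show ?thesis using l by simp
qed

lemma bounded_op_sqrt_iter:
  assumes "bounded_op M B"
  shows "bounded_op M (sqrt_iter B n)"
proof (induction n)
  case (Suc n)
  show ?case unfolding sqrt_iter.simps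
    by (rule bounded_op_scale[OF bounded_op_plus[OF assms bounded_op_comp[OF Suc Suc]]])
qed (simp add: bounded_op_zero)

lemma sqrt_iter_norm:
  assumes B: "effect_op M B"
  shows "f \<in> L2 M \<Longrightarrow> L2_norm M (sqrt_iter B n f) \<le> sqrt_scalar n * L2_norm M f"
proof (induction n arbitrary: f)
  case (Suc n)
  note mem = bounded_op_L2[OF effect_op_bounded[OF B]]
    bounded_op_L2[OF bounded_op_sqrt_iter[OF effect_op_bounded[OF B]]]
  have "L2_norm M (\<lambda>x. B f x + sqrt_iter B n (sqrt_iter B n f) x)
      \<le> L2_norm M (B f) + L2_norm M (sqrt_iter B n (sqrt_iter B n f))"
    by (intro L2_norm_triangle mem Suc.prems)
  also have "\<dots> \<le> L2_norm M f + sqrt_scalar n * (sqrt_scalar n * L2_norm M f)"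
    using Suc.IH[OF mem(2)[OF Suc.prems], of n]
      mult_left_mono[OF Suc.IH[OF Suc.prems] sqrt_scalar_bounds(1)[of n]]
      effect_op_contraction(2)[OF B Suc.prems] by linarith
  finally show ?case
    unfolding sqrt_iter.simps L2_norm_cmult by (simp add: power2_eq_square algebra_simps)
qed (simp add: L2_norm_def)

text \<open>
  \<open>U\<^sup>2 - V\<^sup>2 = U (U - V) + (U - V) V\<close> holds without any commutation of \<open>U\<close> and \<open>V\<close>.
\<close>

lemma square_diff_bound:
  assumes U: "bounded_op M U" and V: "\<And>f. f \<in> L2 M \<Longrightarrow> V f \<in> L2 M"
    and u: "0 \<le> u" "\<And>f. f \<in> L2 M \<Longrightarrow> L2_norm M (U f) \<le> u * L2_norm M f"
    and v: "\<And>f. f \<in> L2 M \<Longrightarrow> L2_norm M (V f) \<le> v * L2_norm M f"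
    and e: "0 \<le> e" "\<And>f. f \<in> L2 M \<Longrightarrow> L2_norm M (\<lambda>x. U f x - V f x) \<le> e * L2_norm M f"
    and f: "f \<in> L2 M"
  shows "L2_norm M (\<lambda>x. U (U f) x - V (V f) x) \<le> (u + v) * e * L2_norm M f"
proof -
  note mem = bounded_op_L2[OF U] V
  have "L2_norm M (\<lambda>x. U (U f) x - V (V f) x)
      \<le> L2_norm M (\<lambda>x. U (U f) x - U (V f) x) + L2_norm M (\<lambda>x. U (V f) x - V (V f) x)"
    by (intro L2_norm_triangle_diff mem f)
  also have "L2_norm M (\<lambda>x. U (U f) x - U (V f) x) = L2_norm M (U (\<lambda>x. U f x - V f x))"
    by (intro L2_norm_cong_ae ae_eq_sym[OF bounded_op_diff[OF U]] L2_diff mem f)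
  also have "\<dots> \<le> u * (e * L2_norm M f)"
    using u(2)[OF L2_diff[OF mem(1)[OF f] mem(2)[OF f]]] mult_left_mono[OF e(2)[OF f] u(1)] by linarith
  also have "L2_norm M (\<lambda>x. U (V f) x - V (V f) x) \<le> e * (v * L2_norm M f)"
    using e(2)[OF V[OF f]] mult_left_mono[OF v[OF f] e(1)] by linarith
  finally show ?thesis by (simp add: algebra_simps)
qed

text \<open>
  Equality holds for scalars, where \<open>a\<^sub>m\<^sub>+\<^sub>1 - a\<^sub>n\<^sub>+\<^sub>1 = (a\<^sub>m + a\<^sub>n) (a\<^sub>m - a\<^sub>n) / 2\<close>; the
  estimate of the difference of squares transfers this recursion to operator norms.
\<close>

lemma sqrt_iter_diff:
  assumes B: "effect_op M B"
  shows "f \<in> L2 M \<Longrightarrow> L2_norm M (\<lambda>x. sqrt_iter B (n + k) f x - sqrt_iter B n f x)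
    \<le> (sqrt_scalar (n + k) - sqrt_scalar n) * L2_norm M f"
proof (induction n arbitrary: f)
  case 0
  then show ?case using sqrt_iter_norm[OF B] by simp
next
  case (Suc n)
  let ?Y = "sqrt_iter B" and ?a = sqrt_scalar
  note bd = bounded_op_sqrt_iter[OF effect_op_bounded[OF B]]
  have "?a n \<le> ?a (n + k)"
    by (rule incseqD[OF incseq_SucI]) (simp_all only: sqrt_scalar_mono le_add1)
  then have "L2_norm M (\<lambda>x. ?Y (n + k) (?Y (n + k) f) x - ?Y n (?Y n f) x)
      \<le> (?a (n + k) + ?a n) * (?a (n + k) - ?a n) * L2_norm M f"
    by (intro square_diff_bound bd bounded_op_L2[OF bd] sqrt_iter_norm[OF B] Suc
        sqrt_scalar_bounds) simp_all
  moreover have "(\<lambda>x. ?Y (Suc n + k) f x - ?Y (Suc n) f x)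
      = (\<lambda>x. (1 / 2) * (?Y (n + k) (?Y (n + k) f) x - ?Y n (?Y n f) x))"
    by (simp add: fun_eq_iff algebra_simps)
  ultimately show ?case
    by (simp only: L2_norm_cmult) (simp add: power2_eq_square field_simps)
qed

lemma positive_op_sqrt_iter:
  assumes B: "effect_op M B"
  shows "positive_op M (sqrt_iter B n)"
proof (induction n)
  case 0
  then show ?case by (simp add: positive_op_def bounded_op_zero L2_inner_def)
next
  case (Suc n)
  let ?Y = "sqrt_iter B"
  have Bp: "positive_op M B" using B by (simp add: effect_op_def)
  note mem = bounded_op_L2[OF positive_op_bounded[OF Bp]]
    bounded_op_L2[OF positive_op_bounded[OF Suc]]
  have "L2_inner M f (?Y (Suc n) f) \<in> \<real>\<^sub>\<ge>\<^sub>0" if f: "f \<in> L2 M" for f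
  proof -
    have "L2_inner M f (?Y (Suc n) f)
        = (1 / 2) * (L2_inner M f (B f) + L2_inner M f (?Y n (?Y n f)))"
      by (simp only: sqrt_iter.simps L2_inner_cmult_right L2_inner_add_right mem f)
    also have "L2_inner M f (?Y n (?Y n f)) = L2_inner M (?Y n f) (?Y n f)"
      using positive_op_symmetric[OF Suc f mem(2)[OF f]] by simp
    also have "(1 / 2) * (L2_inner M f (B f) + \<dots>)
        = of_real ((Re (L2_inner M f (B f)) + (L2_norm M (?Y n f))\<^sup>2) / 2)"
      by (subst positive_op_inner_real(1)[OF Bp f]) (simp add: L2_inner_self)
    also have "\<dots> \<in> \<real>\<^sub>\<ge>\<^sub>0"
      using positive_op_inner_real(2)[OF Bp f] by (simp only: nonneg_Reals_of_real_iff) simp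
    finally show ?thesis .
  qed
  then show ?case
    using bounded_op_sqrt_iter[OF effect_op_bounded[OF B], of "Suc n"] by (simp only: positive_op_def) simp
qed

text \<open>
  A relation rather than a function, so that a root can be exhibited (as for multiplication
  operators) and compared with the one selected by \<open>op_sqrt\<close>.
\<close>

definition op_root :: "'x measure \<Rightarrow> 'x op \<Rightarrow> 'x op \<Rightarrow> bool" where
  "op_root M A R \<longleftrightarrow> positive_op M R \<and> (\<forall>f\<in>L2 M. ae_eq M (R (R f)) (A f))"

lemma op_root_bounded: "op_root M A R \<Longrightarrow> bounded_op M R"
  by (simp add: op_root_def positive_op_def)

lemma op_root_inner:
  assumes R: "op_root M A R" and A: "bounded_op M A" and f: "f \<in> L2 M"
  shows "L2_inner M (R f) (R f) = L2_inner M f (A f)"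
proof -
  note mem = bounded_op_L2[OF op_root_bounded[OF R]]
  have "L2_inner M (R f) (R f) = L2_inner M f (R (R f))"
    using positive_op_symmetric[OF _ f mem[OF f]] R by (simp add: op_root_def)
  also have "\<dots> = L2_inner M f (A f)"
    using R by (intro L2_inner_cong_ae mem f bounded_op_L2[OF A] ae_eq_refl) (auto simp: op_root_def f)
  finally show ?thesis .
qed

lemma op_root_effect:
  assumes A: "effect_op M A" and R: "op_root M A R"
  shows "effect_op M R"
proof (rule effect_opI)
  show "positive_op M R" using R by (simp add: op_root_def)
  fix f assume f: "f \<in> L2 M"
  note mem = bounded_op_L2[OF op_root_bounded[OF R]] bounded_op_L2[OF effect_op_bounded[OF A]]
  have "(L2_norm M (R f))\<^sup>2 = Re (L2_inner M f (A f))"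
    using op_root_inner[OF R effect_op_bounded[OF A] f] by (simp add: L2_inner_self complex_eq_iff)
  also have "\<dots> \<le> L2_norm M f * L2_norm M (A f)"
    by (rule Re_L2_inner_le[OF f mem(2)[OF f]])
  also have "\<dots> \<le> (L2_norm M f)\<^sup>2"
    unfolding power2_eq_square
    by (intro mult_left_mono effect_op_contraction[OF A f] L2_norm_nonneg)
  finally have R_le: "L2_norm M (R f) \<le> L2_norm M f"
    by (rule power2_le_imp_le[OF _ L2_norm_nonneg])
  have "Re (L2_inner M f (R f)) \<le> L2_norm M f * L2_norm M (R f)"
    by (rule Re_L2_inner_le[OF f mem(1)[OF f]])
  also have "\<dots> \<le> (L2_norm M f)\<^sup>2"
    unfolding power2_eq_square by (intro mult_left_mono R_le L2_norm_nonneg)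
  finally show "Re (L2_inner M f (R f)) \<le> (L2_norm M f)\<^sup>2" .
qed

text \<open>
  The uniform approximation of square roots: \<open>1 - R\<close> is a fixed point of the iteration and a
  contraction, so the error satisfies the recursion
  \<open>1 - a\<^sub>n\<^sub>+\<^sub>1 = (1 + a\<^sub>n) (1 - a\<^sub>n) / 2\<close>.
\<close>

lemma op_root_sqrt_iter:
  assumes A: "effect_op M A" and R: "op_root M A R" and f: "f \<in> L2 M"
  shows "L2_norm M (\<lambda>x. (f x - R f x) - sqrt_iter (\<lambda>f x. f x - A f x) n f x)
    \<le> (1 - sqrt_scalar n) * L2_norm M f"
proof -
  define B where "B = (\<lambda>f x. f x - A f x)"
  define Z where "Z = (\<lambda>f x. f x - R f x)"
  have B: "effect_op M B" unfolding B_def by (rule effect_op_compl[OF A])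
  have Z: "effect_op M Z" unfolding Z_def by (rule effect_op_compl[OF op_root_effect[OF A R]])
  note bd = effect_op_bounded[OF Z] bounded_op_sqrt_iter[OF effect_op_bounded[OF B]]
    op_root_bounded[OF R] effect_op_bounded[OF B]
  note mem = bd[THEN bounded_op_L2]
  \<comment> \<open>This is \<open>2 Z = (1 - R\<^sup>2) + (1 - R)\<^sup>2\<close>.\<close>
  have Z_fix: "ae_eq M (Z f) (\<lambda>x. (1 / 2) * (B f x + Z (Z f) x))" if f: "f \<in> L2 M" for f
  proof -
    have "AE x in M. R (\<lambda>x. f x - R f x) x = R f x - R (R f) x"
      using bounded_op_diff[OF bd(3) f mem(3)[OF f]] by (simp add: ae_eq_def)
    moreover have "AE x in M. R (R f) x = A f x"
      using R f by (simp add: op_root_def ae_eq_def)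
    ultimately show ?thesis
      unfolding ae_eq_def by eventually_elim (simp add: B_def Z_def)
  qed
  have "L2_norm M (\<lambda>x. Z f x - sqrt_iter B n f x) \<le> (1 - sqrt_scalar n) * L2_norm M f"
    using f
  proof (induction n arbitrary: f)
    case 0
    then show ?case using effect_op_contraction(2)[OF Z] by simp
  next
    case (Suc n)
    let ?Y = "sqrt_iter B n" and ?a = "sqrt_scalar n"
    have "L2_norm M (\<lambda>x. Z (Z f) x - ?Y (?Y f) x) \<le> (1 + ?a) * (1 - ?a) * L2_norm M f"
      using effect_op_contraction(2)[OF Z] sqrt_scalar_bounds[of n]
      by (intro square_diff_bound bd mem sqrt_iter_norm[OF B] Suc) simp_all
    moreover have "L2_norm M (\<lambda>x. Z f x - sqrt_iter B (Suc n) f x)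
        = L2_norm M (\<lambda>x. (1 / 2) * (Z (Z f) x - ?Y (?Y f) x))"
      using Z_fix[OF Suc.prems]
      by (intro L2_norm_cong_ae L2_diff L2_cmult mem Suc.prems)
         (auto simp: ae_eq_def algebra_simps elim: eventually_mono)
    ultimately show ?case
      by (simp only: L2_norm_cmult) (simp add: power2_eq_square field_simps)
  qed
  then show ?thesis by (simp add: Z_def B_def)
qed

text \<open>
  The root is \<open>1 - Y\<close>, where \<open>Y\<close> is the strong limit of the iterates. It exists because the increments
  are dominated by the telescoping series of the scalar iteration, and passing to the limit in the
  recursion shows \<open>2 Y = B + Y\<^sup>2\<close>, that is \<open>(1 - Y)\<^sup>2 = 1 - B\<close>.
\<close>

lemma op_root_exists:
  assumes A: "effect_op M A"
  shows "\<exists>R. op_root M A R"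
proof -
  define B where "B = (\<lambda>f x. f x - A f x)"
  have B: "effect_op M B" unfolding B_def by (rule effect_op_compl[OF A])
  let ?Y = "sqrt_iter B"
  note bd = bounded_op_sqrt_iter[OF effect_op_bounded[OF B]]
  note mem = bounded_op_L2[OF bd]
  have contr: "L2_norm M (?Y n f) \<le> 1 * L2_norm M f" if "f \<in> L2 M" for n f
    using sqrt_iter_norm[OF B that, of n]
      mult_right_mono[OF sqrt_scalar_bounds(2)[of n] L2_norm_nonneg[of M f]] by linarith
  have "\<exists>F. L2_lim M (\<lambda>n. ?Y n f) F" if f: "f \<in> L2 M" for f
  proof -
    let ?d = "\<lambda>k x. ?Y (Suc k) f x - ?Y k f x"
    have "summable (\<lambda>k. L2_norm M (?d k))"
    proof (rule summable_comparison_test')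
      show "summable (\<lambda>k. (sqrt_scalar (Suc k) - sqrt_scalar k) * L2_norm M f)"
        using telescope_summable[OF sqrt_scalar_lim] by (rule summable_mult2)
      show "norm (L2_norm M (?d k)) \<le> (sqrt_scalar (Suc k) - sqrt_scalar k) * L2_norm M f"
        if "k \<ge> 0" for k
        using sqrt_iter_diff[OF B f, of k 1] by (simp add: L2_norm_nonneg del: sqrt_iter.simps)
    qed
    then have "\<exists>F. L2_lim M (\<lambda>n x. \<Sum>k<n. ?d k x) F"
      by (intro L2_complete L2_diff mem f)
    moreover have "(\<Sum>k<n. ?d k x) = ?Y n f x" for n x
      using sum_lessThan_telescope[of "\<lambda>k. ?Y k f x" n] by simp
    ultimately show ?thesis by (simp del: sqrt_iter.simps)
  qed
  then obtain Y where Y: "L2_lim M (\<lambda>n. ?Y n f) (Y f)" if "f \<in> L2 M" for f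
    by metis
  have Y_mem: "Y f \<in> L2 M" if "f \<in> L2 M" for f
    using Y[OF that] by (rule L2_limD)
  have Y_norm: "L2_norm M (Y f) \<le> 1 * L2_norm M f" if "f \<in> L2 M" for f
    using L2_lim_norm[OF Y[OF that]] contr[OF that] by (auto intro: LIMSEQ_le_const2)
  have Y_bd: "bounded_op M Y"
  proof (rule bounded_opI[OF Y_mem _ _ _ Y_norm])
    fix f g :: "'a \<Rightarrow> complex" and c assume f: "f \<in> L2 M"
    have "L2_lim M (\<lambda>n. ?Y n (\<lambda>x. c * f x)) (\<lambda>x. c * Y f x)"
      by (rule L2_lim_cong[OF L2_lim_cmult[OF Y[OF f]]])
         (auto intro!: mem L2_cmult f ae_eq_sym[OF bounded_op_cmult[OF bd f]])
    then show "ae_eq M (Y (\<lambda>x. c * f x)) (\<lambda>x. c * Y f x)"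
      by (rule L2_lim_unique[OF Y[OF L2_cmult[OF f]]])
    assume g: "g \<in> L2 M"
    have "L2_lim M (\<lambda>n. ?Y n (\<lambda>x. f x + g x)) (\<lambda>x. Y f x + Y g x)"
      by (rule L2_lim_cong[OF L2_lim_add[OF Y[OF f] Y[OF g]]])
         (auto intro!: mem L2_add f g ae_eq_sym[OF bounded_op_add[OF bd f g]])
    then show "ae_eq M (Y (\<lambda>x. f x + g x)) (\<lambda>x. Y f x + Y g x)"
      by (rule L2_lim_unique[OF Y[OF L2_add[OF f g]]])
    assume "ae_eq M f g"
    then have "L2_lim M (\<lambda>n. ?Y n g) (Y f)"
      by (intro L2_lim_cong[OF Y[OF f]] mem g bounded_op_cong[OF bd f g])
    then show "ae_eq M (Y f) (Y g)"
      by (rule L2_lim_unique[OF _ Y[OF g]])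
  qed
  have Y_fix: "ae_eq M (Y f) (\<lambda>x. (1 / 2) * (B f x + Y (Y f) x))" if f: "f \<in> L2 M" for f
  proof (rule L2_lim_unique)
    have "L2_lim M (\<lambda>n. ?Y n (?Y n f)) (Y (Y f))"
      by (rule strong_lim_moving[OF bd contr Y[OF Y_mem[OF f]] Y[OF f]])
    then show "L2_lim M (\<lambda>n. ?Y (Suc n) f) (\<lambda>x. (1 / 2) * (B f x + Y (Y f) x))"
      unfolding sqrt_iter.simps
      by (intro L2_lim_cmult L2_lim_add L2_lim_const bounded_op_L2[OF effect_op_bounded[OF B]] f)
    show "L2_lim M (\<lambda>n. ?Y (Suc n) f) (Y f)"
      using Y[OF f] LIMSEQ_Suc[OF L2_limD(3)[OF Y[OF f]]]
      by (simp add: L2_lim_def del: sqrt_iter.simps)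
  qed
  have "positive_op M Y"
    unfolding positive_op_def
  proof (intro conjI ballI Y_bd)
    fix f assume f: "f \<in> L2 M"
    have lim: "(\<lambda>n. L2_inner M f (?Y n f)) \<longlonglongrightarrow> L2_inner M f (Y f)"
      by (rule L2_lim_inner[OF L2_lim_const[OF f] Y[OF f]])
    have "L2_inner M f (?Y n f) \<in> \<real>\<^sub>\<ge>\<^sub>0" for n
      using positive_op_sqrt_iter[OF B, of n] f by (simp add: positive_op_def)
    then show "L2_inner M f (Y f) \<in> \<real>\<^sub>\<ge>\<^sub>0"
      by (rule closed_sequentially[OF closed_nonneg_Reals_complex _ lim])
  qed
  then have "effect_op M Y"
  proof (rule effect_opI)
    fix f assume f: "f \<in> L2 M"
    have "Re (L2_inner M f (Y f)) \<le> L2_norm M f * L2_norm M (Y f)"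
      by (rule Re_L2_inner_le[OF f Y_mem[OF f]])
    also have "\<dots> \<le> (L2_norm M f)\<^sup>2"
      using Y_norm[OF f] by (simp add: power2_eq_square mult_left_mono L2_norm_nonneg)
    finally show "Re (L2_inner M f (Y f)) \<le> (L2_norm M f)\<^sup>2" .
  qed
  then have "positive_op M (\<lambda>f x. f x - Y f x)" by (simp add: effect_op_def)
  moreover have "ae_eq M (\<lambda>x. f x - Y f x - Y (\<lambda>x. f x - Y f x) x) (A f)" if f: "f \<in> L2 M" for f
    using Y_fix[OF f] bounded_op_diff[OF Y_bd f Y_mem[OF f]]
    unfolding ae_eq_def
  proof eventually_elim
    case (elim x)
    have "2 * Y f x = f x - A f x + Y (Y f) x" using elim(1) by (simp add: B_def mult.commute)
    then show ?case unfolding elim(2) by algebra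
  qed
  ultimately have "op_root M A (\<lambda>f x. f x - Y f x)"
    by (simp add: op_root_def)
  then show ?thesis by blast
qed

lemma op_root_op_sqrt:
  assumes "effect_op M A"
  shows "op_root M A (op_sqrt M A)"
  using someI_ex[OF op_root_exists[OF assms]] by (simp add: op_sqrt_def op_root_def)

lemma sqrt_iter_lim:
  assumes B: "\<And>n. effect_op M (B n)" and B': "effect_op M B'"
    and lim: "\<And>f. f \<in> L2 M \<Longrightarrow> L2_lim M (\<lambda>n. B n f) (B' f)"
  shows "L2_lim M X F \<Longrightarrow> L2_lim M (\<lambda>n. sqrt_iter (B n) k (X n)) (sqrt_iter B' k F)"
proof (induction k arbitrary: X F)
  case 0
  then show ?case by (simp add: L2_lim_const L2_zero)
next
  case (Suc k)
  have "L2_lim M (\<lambda>n. B n (X n)) (B' F)"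
    using effect_op_contraction(2)[OF B]
    by (intro strong_lim_moving[where C=1, OF effect_op_bounded[OF B] _ lim Suc.prems]
        L2_limD(2)[OF Suc.prems]) simp
  then show ?case
    unfolding sqrt_iter.simps by (intro L2_lim_cmult L2_lim_add Suc)
qed

text \<open>
  Strong continuity of the square root on effects. Replacing each root by its \<open>k\<close>-th approximation costs
  at most \<open>1 - a\<^sub>k\<close> times the norm of the vector, uniformly in \<open>n\<close>; for fixed \<open>k\<close> the
  approximations converge.
\<close>

lemma op_root_lim:
  assumes A: "\<And>n. effect_op M (A n)" and A': "effect_op M A'"
    and lim: "\<And>f. f \<in> L2 M \<Longrightarrow> L2_lim M (\<lambda>n. A n f) (A' f)"
    and R: "\<And>n. op_root M (A n) (R n)" and R': "op_root M A' R'"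
    and X: "L2_lim M X F"
  shows "L2_lim M (\<lambda>n. R n (X n)) (R' F)"
proof -
  define Y where "Y n = sqrt_iter (\<lambda>f x. f x - A n f x)" for n
  define Y' where "Y' = sqrt_iter (\<lambda>f x. f x - A' f x)"
  note mem = L2_limD(1,2)[OF X]
  have Y_mem: "Y n k f \<in> L2 M" "Y' k f \<in> L2 M" "R n f \<in> L2 M" "R' f \<in> L2 M"
    if "f \<in> L2 M" for n k f
    unfolding Y_def Y'_def using that
    by (auto intro: bounded_op_L2[OF bounded_op_sqrt_iter[OF effect_op_bounded[OF effect_op_compl]]]
        A A' bounded_op_L2[OF op_root_bounded[OF R]] bounded_op_L2[OF op_root_bounded[OF R']])
  let ?D = "\<lambda>n x. R n (X n) x - R' F x"
  let ?E = "\<lambda>k n x. (X n x - Y n k (X n) x) - (F x - Y' k F x)"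
  have E_lim: "(\<lambda>n. L2_norm M (?E k n)) \<longlonglongrightarrow> 0" for k
  proof -
    have "L2_lim M (\<lambda>n. Y n k (X n)) (Y' k F)"
      unfolding Y_def Y'_def
      by (intro sqrt_iter_lim effect_op_compl A A' X L2_lim_diff L2_lim_const lim)
    from L2_limD(3)[OF L2_lim_diff[OF X this]] show ?thesis .
  qed
  have D_le: "L2_norm M (?D n)
      \<le> (1 - sqrt_scalar k) * (L2_norm M (X n) + L2_norm M F) + L2_norm M (?E k n)" for n k
  proof -
    let ?P = "\<lambda>x. (X n x - R n (X n) x) - Y n k (X n) x"
    let ?Q = "\<lambda>x. (F x - R' F x) - Y' k F x"
    have PQ: "?P \<in> L2 M" "?Q \<in> L2 M" "?E k n \<in> L2 M"
      by (intro L2_diff mem Y_mem)+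
    have "?D n = (\<lambda>x. (?E k n x - ?P x) + ?Q x)" by (simp add: fun_eq_iff)
    moreover have "L2_norm M (\<lambda>x. (?E k n x - ?P x) + ?Q x)
        \<le> L2_norm M (\<lambda>x. ?E k n x - ?P x) + L2_norm M ?Q"
      by (intro L2_norm_triangle L2_diff[OF PQ(3,1)] PQ)
    moreover have "L2_norm M (\<lambda>x. ?E k n x - ?P x) \<le> L2_norm M (?E k n) + L2_norm M ?P"
      using L2_norm_triangle_diff[OF PQ(3) L2_zero PQ(1)] L2_norm_minus_commute[of M "\<lambda>x. 0" ?P]
      by simp
    moreover have "L2_norm M ?P \<le> (1 - sqrt_scalar k) * L2_norm M (X n)"
      unfolding Y_def by (rule op_root_sqrt_iter[OF A R mem(1)])
    moreover have "L2_norm M ?Q \<le> (1 - sqrt_scalar k) * L2_norm M F"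
      unfolding Y'_def by (rule op_root_sqrt_iter[OF A' R' mem(2)])
    ultimately show ?thesis by (simp only: distrib_left)
  qed
  obtain K where K: "L2_norm M (X n) \<le> K" for n
    using convergent_imp_Bseq[OF convergentI[OF L2_lim_norm[OF X]]]
    by (auto simp: Bseq_def abs_le_iff)
  have "(\<lambda>n. L2_norm M (?D n)) \<longlonglongrightarrow> 0"
  proof (rule LIMSEQ_I)
    fix r :: real assume r: "r > 0"
    have "(\<lambda>k. (1 - sqrt_scalar k) * (K + L2_norm M F)) \<longlonglongrightarrow> (1 - 1) * (K + L2_norm M F)"
      by (intro tendsto_intros sqrt_scalar_lim)
    then have "eventually (\<lambda>k. (1 - sqrt_scalar k) * (K + L2_norm M F) < r / 2) sequentially"
      using r by (intro order_tendstoD(2)) auto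
    then obtain k where k: "(1 - sqrt_scalar k) * (K + L2_norm M F) < r / 2"
      by (auto simp: eventually_sequentially)
    obtain n0 where n0: "L2_norm M (?E k n) < r / 2" if "n \<ge> n0" for n
      using order_tendstoD(2)[OF E_lim[of k], of "r / 2"] r by (auto simp: eventually_sequentially)
    have "norm (L2_norm M (?D n) - 0) < r" if "n \<ge> n0" for n
    proof -
      have "(1 - sqrt_scalar k) * (L2_norm M (X n) + L2_norm M F)
          \<le> (1 - sqrt_scalar k) * (K + L2_norm M F)"
        using K[of n] sqrt_scalar_bounds(2)[of k] by (intro mult_left_mono) auto
      then show ?thesis
        using D_le[of n k] k n0[OF that] by (simp add: L2_norm_nonneg)
    qed
    then show "\<exists>n0. \<forall>n\<ge>n0. norm (L2_norm M (?D n) - 0) < r" by blast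
  qed
  then show ?thesis by (simp add: L2_lim_def Y_mem mem)
qed

text \<open>
  Apply continuity to a constant sequence of operators.
\<close>

lemma op_root_unique:
  assumes A: "effect_op M A" and R: "op_root M A R" "op_root M A S" and f: "f \<in> L2 M"
  shows "ae_eq M (R f) (S f)"
proof -
  have "L2_lim M (\<lambda>n. R f) (S f)"
    by (rule op_root_lim[OF A A L2_lim_const R L2_lim_const[OF f]])
       (rule bounded_op_L2[OF effect_op_bounded[OF A]])
  with L2_lim_const[OF bounded_op_L2[OF op_root_bounded[OF R(1)] f]] show ?thesis
    by (rule L2_lim_unique)
qed

section \<open>Projections and compressions\<close>

lemma orthonormal_basisD:
  assumes "orthonormal_basis M \<phi>"
  shows "\<phi> j \<in> L2 M" "L2_inner M (\<phi> i) (\<phi> j) = (if i = j then 1 else 0)"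
  using assms by (auto simp: orthonormal_basis_def)

lemma inner_basis_span:
  assumes "orthonormal_basis M \<phi>" "i < L"
  shows "L2_inner M (\<phi> i) (\<lambda>x. \<Sum>j<L. c j * \<phi> j x) = c i"
proof -
  note onb = orthonormal_basisD[OF assms(1)]
  have "L2_inner M (\<phi> i) (\<lambda>x. \<Sum>j<L. c j * \<phi> j x) = (\<Sum>j<L. c j * (if i = j then 1 else 0))"
    by (simp add: L2_inner_sum_right L2_inner_cmult_right L2_cmult onb)
  then show ?thesis using assms(2) by (simp add: if_distrib cong: if_cong)
qed

lemma proj_eq:
  assumes onb: "orthonormal_basis M \<phi>" and f: "f \<in> L2 M"
  shows "proj M \<phi> L f = (\<lambda>x. \<Sum>j<L. L2_inner M (\<phi> j) f * \<phi> j x)"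
  unfolding proj_def
proof (rule the_equality)
  note onbD = orthonormal_basisD[OF onb]
  have span_L2: "(\<lambda>x. \<Sum>j<L. c j * \<phi> j x) \<in> L2 M" for c
    by (intro L2_sum L2_cmult onbD)
  let ?g = "\<lambda>x. \<Sum>j<L. L2_inner M (\<phi> j) f * \<phi> j x"
  show "?g \<in> span_upto \<phi> L \<and> (\<forall>k\<in>span_upto \<phi> L. L2_inner M k (\<lambda>x. f x - ?g x) = 0)"
  proof (intro conjI ballI)
    fix k assume "k \<in> span_upto \<phi> L"
    then obtain c where k: "k = (\<lambda>x. \<Sum>j<L. c j * \<phi> j x)"
      by (auto simp: span_upto_def)
    have "L2_inner M (\<lambda>x. f x - ?g x) k = (\<Sum>j<L. c j * cnj (L2_inner M (\<phi> j) (\<lambda>x. f x - ?g x)))"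
      unfolding k
      by (simp add: L2_inner_sum_right L2_inner_cmult_right L2_cmult onbD L2_diff f span_L2
          flip: L2_inner_commute)
    also have "\<dots> = 0"
      by (simp add: L2_inner_diff_right onbD f span_L2 inner_basis_span[OF onb])
    finally show "L2_inner M k (\<lambda>x. f x - ?g x) = 0"
      by (subst L2_inner_commute) simp
  qed (auto simp: span_upto_def)
  fix g assume g: "g \<in> span_upto \<phi> L \<and> (\<forall>k\<in>span_upto \<phi> L. L2_inner M k (\<lambda>x. f x - g x) = 0)"
  then obtain c where c: "g = (\<lambda>x. \<Sum>j<L. c j * \<phi> j x)"
    by (auto simp: span_upto_def)
  have "c j = L2_inner M (\<phi> j) f" if j: "j < L" for j
  proof -
    have "\<phi> j = (\<lambda>x. \<Sum>i<L. (if i = j then 1 else 0) * \<phi> i x)"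
      using j by (simp add: if_distrib[of "\<lambda>z. z * _"] cong: if_cong)
    then have "\<phi> j \<in> span_upto \<phi> L"
      unfolding span_upto_def by (intro CollectI exI[of _ "\<lambda>i. if i = j then 1 else 0"] conjI TrueI)
    then have "L2_inner M (\<phi> j) (\<lambda>x. f x - g x) = 0" using g by blast
    then show ?thesis
      using inner_basis_span[OF onb j, of c]
      by (simp add: c L2_inner_diff_right onbD f span_L2)
  qed
  then show "g = ?g" unfolding c by (simp add: fun_eq_iff)
qed

context
  fixes M :: "'x measure" and \<phi> :: "nat \<Rightarrow> 'x \<Rightarrow> complex"
  assumes onb: "orthonormal_basis M \<phi>"
begin

lemma proj_L2: "f \<in> L2 M \<Longrightarrow> proj M \<phi> L f \<in> L2 M"
  unfolding proj_eq[OF onb] by (intro L2_sum L2_cmult orthonormal_basisD[OF onb])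

lemma inner_proj:
  assumes f: "f \<in> L2 M" and g: "g \<in> L2 M"
  shows "L2_inner M f (proj M \<phi> L g) = (\<Sum>j<L. L2_inner M f (\<phi> j) * L2_inner M (\<phi> j) g)"
  unfolding proj_eq[OF onb g]
  by (simp add: L2_inner_sum_right L2_inner_cmult_right L2_cmult orthonormal_basisD[OF onb] f)
     (simp add: mult.commute)

lemma proj_symmetric:
  assumes f: "f \<in> L2 M" and g: "g \<in> L2 M"
  shows "L2_inner M (proj M \<phi> L f) g = L2_inner M f (proj M \<phi> L g)"
proof -
  have "L2_inner M (proj M \<phi> L f) g = cnj (\<Sum>j<L. L2_inner M g (\<phi> j) * L2_inner M (\<phi> j) f)"
    using inner_proj[OF g f] L2_inner_commute[of M "proj M \<phi> L f" g] by simp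
  also have "\<dots> = (\<Sum>j<L. L2_inner M (\<phi> j) g * L2_inner M f (\<phi> j))"
    by (simp flip: L2_inner_commute)
  finally show ?thesis by (simp add: inner_proj[OF f g] mult.commute)
qed

lemma proj_span:
  assumes g: "g \<in> span_upto \<phi> K" and KL: "K \<le> L"
  shows "g \<in> L2 M" "proj M \<phi> L g = g"
proof -
  obtain b where b: "g = (\<lambda>x. \<Sum>j<K. b j * \<phi> j x)"
    using g by (auto simp: span_upto_def)
  have "(\<Sum>j<K. b j * \<phi> j x) = (\<Sum>j<L. (if j < K then b j else 0) * \<phi> j x)" for x
    using KL by (intro sum.mono_neutral_cong_left) auto
  then have c: "g = (\<lambda>x. \<Sum>j<L. (if j < K then b j else 0) * \<phi> j x)"
    unfolding b by simp
  show g_L2: "g \<in> L2 M"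
    unfolding c by (intro L2_sum L2_cmult orthonormal_basisD[OF onb])
  have "L2_inner M (\<phi> j) g = (if j < K then b j else 0)" if "j < L" for j
    unfolding c by (rule inner_basis_span[OF onb that])
  then show "proj M \<phi> L g = g"
    unfolding proj_eq[OF onb g_L2] by (subst (2) c) (auto intro!: sum.cong)
qed

lemma proj_idem: "f \<in> L2 M \<Longrightarrow> proj M \<phi> L (proj M \<phi> L f) = proj M \<phi> L f"
  by (rule proj_span[where K=L]) (auto simp: proj_eq[OF onb] span_upto_def)

lemma proj_contraction:
  assumes f: "f \<in> L2 M"
  shows "L2_norm M (proj M \<phi> L f) \<le> L2_norm M f"
proof (cases "L2_norm M (proj M \<phi> L f) = 0")
  case False
  have "L2_inner M (proj M \<phi> L f) (proj M \<phi> L f) = L2_inner M f (proj M \<phi> L f)"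
    using proj_symmetric[OF f proj_L2[OF f]] proj_idem[OF f] by simp
  then have "(L2_norm M (proj M \<phi> L f))\<^sup>2 = Re (L2_inner M f (proj M \<phi> L f))"
    by (simp add: L2_inner_self complex_eq_iff)
  also have "\<dots> \<le> L2_norm M f * L2_norm M (proj M \<phi> L f)"
    by (rule Re_L2_inner_le[OF f proj_L2[OF f]])
  finally show ?thesis
    using False L2_norm_nonneg[of M "proj M \<phi> L f"] by (simp add: power2_eq_square)
qed (simp add: L2_norm_nonneg)

lemma proj_cmult: "f \<in> L2 M \<Longrightarrow> proj M \<phi> L (\<lambda>x. c * f x) = (\<lambda>x. c * proj M \<phi> L f x)"
  by (simp add: proj_eq[OF onb] L2_cmult L2_inner_cmult_right sum_distrib_left mult.assoc)

lemma effect_op_proj: "effect_op M (proj M \<phi> L)"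
proof (rule effect_opI)
  have "bounded_op M (proj M \<phi> L)"
  proof (rule bounded_opI[where C=1])
    fix f g assume f: "f \<in> L2 M" and g: "g \<in> L2 M"
    show "ae_eq M (proj M \<phi> L (\<lambda>x. f x + g x)) (\<lambda>x. proj M \<phi> L f x + proj M \<phi> L g x)"
      by (simp add: proj_eq[OF onb] L2_add f g L2_inner_add_right orthonormal_basisD[OF onb]
          distrib_right sum.distrib ae_eq_refl)
    assume eq: "ae_eq M f g"
    have "L2_inner M (\<phi> j) f = L2_inner M (\<phi> j) g" for j
      by (intro L2_inner_cong_ae orthonormal_basisD[OF onb] f g ae_eq_refl eq)
    then show "ae_eq M (proj M \<phi> L f) (proj M \<phi> L g)"
      by (simp add: proj_eq[OF onb] f g ae_eq_refl)
  qed (simp_all add: proj_L2 proj_contraction proj_cmult ae_eq_refl)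
  moreover have "L2_inner M f (proj M \<phi> L f) \<in> \<real>\<^sub>\<ge>\<^sub>0" if f: "f \<in> L2 M" for f
  proof -
    have "L2_inner M f (proj M \<phi> L f) = of_real ((L2_norm M (proj M \<phi> L f))\<^sup>2)"
      using proj_symmetric[OF f proj_L2[OF f], of L L] proj_idem[OF f, of L]
      by (simp only: L2_inner_self[symmetric])
    then show ?thesis by (simp only: nonneg_Reals_of_real_iff) simp
  qed
  ultimately show "positive_op M (proj M \<phi> L)"
    by (simp add: positive_op_def)
  fix f assume f: "f \<in> L2 M"
  have "Re (L2_inner M f (proj M \<phi> L f)) \<le> L2_norm M f * L2_norm M (proj M \<phi> L f)"
    by (rule Re_L2_inner_le[OF f proj_L2[OF f]])
  also have "\<dots> \<le> (L2_norm M f)\<^sup>2"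
    unfolding power2_eq_square by (intro mult_left_mono proj_contraction f L2_norm_nonneg)
  finally show "Re (L2_inner M f (proj M \<phi> L f)) \<le> (L2_norm M f)\<^sup>2" .
qed

text \<open>
  The projection fixes an approximating element \<open>g\<close> of a smaller span, so its error at \<open>f\<close> equals its
  error at \<open>f - g\<close>, which has at most the norm of \<open>f - g\<close>.
\<close>

lemma proj_lim:
  assumes f: "f \<in> L2 M"
  shows "L2_lim M (\<lambda>L. proj M \<phi> L f) f"
  unfolding L2_lim_def
proof (intro conjI allI proj_L2 f LIMSEQ_I)
  fix r :: real assume "r > 0"
  then obtain K g where g: "g \<in> span_upto \<phi> K" "L2_norm M (\<lambda>x. f x - g x) < r"
    using onb f unfolding orthonormal_basis_def by blast
  have "norm (L2_norm M (\<lambda>x. proj M \<phi> L f x - f x) - 0) < r" if "L \<ge> K" for L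
  proof -
    note gL = proj_span[OF g(1) that]
    let ?h = "\<lambda>x. f x - g x"
    have h: "?h \<in> L2 M" by (intro L2_diff f gL)
    have "ae_eq M (\<lambda>x. f x - proj M \<phi> L f x) (\<lambda>x. ?h x - proj M \<phi> L ?h x)"
      using bounded_op_diff[OF effect_op_bounded[OF effect_op_proj] f gL(1), of L]
      unfolding ae_eq_def by eventually_elim (simp add: gL(2))
    then have "L2_norm M (\<lambda>x. f x - proj M \<phi> L f x) = L2_norm M (\<lambda>x. ?h x - proj M \<phi> L ?h x)"
      by (intro L2_norm_cong_ae L2_diff f h proj_L2)
    also have "\<dots> \<le> L2_norm M ?h"
      by (rule effect_op_contraction(2)[OF effect_op_compl[OF effect_op_proj] h])
    finally show ?thesis
      using g(2) L2_norm_minus_commute[of M f "proj M \<phi> L f"] by (simp add: L2_norm_nonneg)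
  qed
  then show "\<exists>K. \<forall>L\<ge>K. norm (L2_norm M (\<lambda>x. proj M \<phi> L f x - f x) - 0) < r" by blast
qed

lemma effect_op_compress:
  assumes A: "effect_op M A"
  shows "effect_op M (compress M \<phi> L A)"
proof (rule effect_opI)
  let ?P = "proj M \<phi> L"
  note P = effect_op_bounded[OF effect_op_proj]
  have pos: "positive_op M A" using A by (simp add: effect_op_def)
  have inner: "L2_inner M f (compress M \<phi> L A f) = L2_inner M (?P f) (A (?P f))" if "f \<in> L2 M" for f
    using that by (simp add: compress_def proj_symmetric proj_L2 bounded_op_L2[OF effect_op_bounded[OF A]])
  have "bounded_op M (compress M \<phi> L A)"
    unfolding compress_def comp_def
    by (rule bounded_op_comp[OF P bounded_op_comp[OF effect_op_bounded[OF A] P]])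
  then show "positive_op M (compress M \<phi> L A)"
    using pos by (simp add: positive_op_def inner proj_L2)
  fix f assume f: "f \<in> L2 M"
  have "Re (L2_inner M (?P f) (A (?P f))) \<le> L2_norm M (?P f) * L2_norm M (A (?P f))"
    by (rule Re_L2_inner_le[OF proj_L2[OF f] bounded_op_L2[OF effect_op_bounded[OF A] proj_L2[OF f]]])
  also have "\<dots> \<le> L2_norm M f * L2_norm M f"
    using effect_op_contraction(2)[OF A proj_L2[OF f]] proj_contraction[OF f]
    by (intro mult_mono L2_norm_nonneg) (auto intro: order_trans)
  finally show "Re (L2_inner M f (compress M \<phi> L A f)) \<le> (L2_norm M f)\<^sup>2"
    by (simp add: inner f power2_eq_square)
qed

lemma compress_lim:
  assumes A: "bounded_op M A" and f: "f \<in> L2 M"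
  shows "L2_lim M (\<lambda>L. compress M \<phi> L A f) (A f)"
  unfolding compress_def comp_def
proof (rule strong_lim_moving[where C=1 and F="A f" and T="\<lambda>L. proj M \<phi> L"])
  show "L2_lim M (\<lambda>L. A (proj M \<phi> L f)) (A f)"
    by (rule bounded_op_lim[OF A proj_lim[OF f]])
  show "L2_lim M (\<lambda>L. proj M \<phi> L (A f)) (A f)"
    by (rule proj_lim[OF bounded_op_L2[OF A f]])
qed (simp_all add: proj_contraction effect_op_bounded[OF effect_op_proj])

end

section \<open>Rank one density operators\<close>

text \<open>
  In every orthonormal basis the partial sums of the diagonal are \<open>c \<langle>u, P\<^sub>n v\<rangle>\<close>, with \<open>P\<^sub>n\<close> the
  projections of that basis. The given basis ensures that the description defining the trace is
  satisfied by one value only.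
\<close>

lemma op_trace_rank_one:
  assumes onb: "orthonormal_basis M \<phi>" and u: "u \<in> L2 M" and v: "v \<in> L2 M"
    and T: "\<And>g. g \<in> L2 M \<Longrightarrow> T g \<in> L2 M"
      "\<And>g. g \<in> L2 M \<Longrightarrow> ae_eq M (T g) (\<lambda>x. c * L2_inner M u g * v x)"
  shows "op_trace M T = c * L2_inner M u v"
  unfolding op_trace_def
proof (rule the_equality)
  have sums: "(\<lambda>j. L2_inner M (e j) (T (e j))) sums (c * L2_inner M u v)"
    if e: "orthonormal_basis M e" for e
  proof -
    note eD = orthonormal_basisD[OF e]
    have "L2_inner M (e j) (T (e j)) = c * (L2_inner M u (e j) * L2_inner M (e j) v)" for j
    proof -
      have "L2_inner M (e j) (T (e j)) = L2_inner M (e j) (\<lambda>x. c * L2_inner M u (e j) * v x)"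
        by (intro L2_inner_cong_ae eD T L2_cmult v ae_eq_refl)
      then show ?thesis by (simp add: L2_inner_cmult_right mult.assoc)
    qed
    then have "(\<Sum>j<n. L2_inner M (e j) (T (e j))) = c * L2_inner M u (proj M e n v)" for n
      by (simp add: inner_proj[OF e u v] sum_distrib_left)
    moreover have "(\<lambda>n. c * L2_inner M u (proj M e n v)) \<longlonglongrightarrow> c * L2_inner M u v"
      by (intro tendsto_mult_left L2_lim_inner L2_lim_const u proj_lim[OF e v])
    ultimately show ?thesis by (simp add: sums_def)
  qed
  then show "\<forall>e. orthonormal_basis M e \<longrightarrow>
      (\<lambda>j. L2_inner M (e j) (T (e j))) sums (c * L2_inner M u v)" by blast
  fix t assume "\<forall>e. orthonormal_basis M e \<longrightarrow> (\<lambda>j. L2_inner M (e j) (T (e j))) sums t"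
  then show "t = c * L2_inner M u v" using sums onb sums_unique2 by blast
qed

section \<open>Multiplication operators\<close>

lemma bounded_op_mult:
  assumes f: "f \<in> Linf M"
  shows "bounded_op M (mult_op f)"
proof -
  have [measurable]: "f \<in> borel_measurable M" using f by (simp add: Linf_def)
  obtain C where "AE x in M. norm (f x) \<le> C" using f by (auto simp: Linf_def)
  then have C: "AE x in M. (norm (f x * g x))\<^sup>2 \<le> \<bar>C\<bar>\<^sup>2 * (norm (g x))\<^sup>2" for g :: "'a \<Rightarrow> complex"
    by eventually_elim (auto simp: norm_mult power_mult_distrib intro!: mult_right_mono power_mono)
  have mem: "(\<lambda>x. f x * g x) \<in> L2 M" if g: "g \<in> L2 M" for g
    using L2_measurable[OF g] L2_integrable[OF g] by (intro L2_dominated[OF _ _ C]) auto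
  show ?thesis
  proof (rule bounded_opI)
    fix g assume g: "g \<in> L2 M"
    have "(L2_norm M (mult_op f g))\<^sup>2 \<le> (\<integral>x. \<bar>C\<bar>\<^sup>2 * (norm (g x))\<^sup>2 \<partial>M)"
      unfolding L2_norm_square mult_op_def
      using L2_integrable[OF mem[OF g]] L2_integrable[OF g] by (intro integral_mono_AE C) auto
    also have "\<dots> = (\<bar>C\<bar> * L2_norm M g)\<^sup>2"
      by (simp add: L2_norm_square power_mult_distrib)
    finally show "L2_norm M (mult_op f g) \<le> \<bar>C\<bar> * L2_norm M g"
      by (rule power2_le_imp_le) (simp add: L2_norm_nonneg)
  qed (auto simp: mult_op_def mem ae_eq_def distrib_left mult.left_commute elim: eventually_mono)
qed

lemma L2_inner_mult_left:
  "L2_inner M g (mult_op f h) = L2_inner M (\<lambda>x. cnj (f x) * g x) h"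
  by (simp add: L2_inner_def mult_op_def mult_ac)

context
  fixes M :: "'x measure" and t :: "'x \<Rightarrow> real"
  assumes t_meas [measurable]: "t \<in> borel_measurable M"
    and t01: "\<And>x. x \<in> space M \<Longrightarrow> 0 \<le> t x \<and> t x \<le> 1"
begin

lemma unit_interval_Linf: "(\<lambda>x. complex_of_real (t x)) \<in> Linf M"
  using t01 by (auto simp: Linf_def intro!: exI[of _ 1] AE_I2)

lemma effect_op_mult: "effect_op M (mult_op (\<lambda>x. complex_of_real (t x)))"
proof (rule effect_opI)
  let ?e = "\<lambda>x. complex_of_real (t x)"
  have inner: "L2_inner M f (mult_op ?e f) = of_real (\<integral>x. t x * (norm (f x))\<^sup>2 \<partial>M)" for f
  proof -
    have "L2_inner M f (mult_op ?e f) = (\<integral>x. of_real (t x * (norm (f x))\<^sup>2) \<partial>M)"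
      unfolding L2_inner_def mult_op_def
      by (intro Bochner_Integration.integral_cong)
         (auto simp: complex_norm_square mult_ac simp del: of_real_power)
    then show ?thesis by (simp only: integral_complex_of_real)
  qed
  have "0 \<le> (\<integral>x. t x * (norm (f x))\<^sup>2 \<partial>M)" for f :: "'x \<Rightarrow> complex"
    using t01 by (intro Bochner_Integration.integral_nonneg) auto
  then show "positive_op M (mult_op ?e)"
    by (simp add: positive_op_def bounded_op_mult[OF unit_interval_Linf] inner)
  fix f assume f: "f \<in> L2 M"
  have [measurable]: "f \<in> borel_measurable M" using f by (rule L2_measurable)
  have le: "t x * (norm (f x))\<^sup>2 \<le> (norm (f x))\<^sup>2" if "x \<in> space M" for x
    using t01[OF that] by (simp add: mult_left_le_one_le)
  have "integrable M (\<lambda>x. t x * (norm (f x))\<^sup>2)"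
    by (rule Bochner_Integration.integrable_bound[OF L2_integrable[OF f]])
       (use le t01 in \<open>auto intro!: AE_I2 simp: abs_mult\<close>)
  then show "Re (L2_inner M f (mult_op ?e f)) \<le> (L2_norm M f)\<^sup>2"
    unfolding inner L2_norm_square using L2_integrable[OF f] le by (simp add: integral_mono)
qed

end

text \<open>
  Identifies the abstractly selected root of a multiplication operator, by uniqueness.
\<close>

lemma op_root_mult:
  assumes t [measurable]: "t \<in> borel_measurable M"
    and t01: "\<And>x. x \<in> space M \<Longrightarrow> 0 \<le> t x \<and> t x \<le> 1"
  shows "op_root M (mult_op (\<lambda>x. complex_of_real (t x))) (mult_op (\<lambda>x. complex_of_real (sqrt (t x))))"
proof -
  have "effect_op M (mult_op (\<lambda>x. complex_of_real (sqrt (t x))))"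
    using t01 by (intro effect_op_mult) auto
  moreover have "of_real (sqrt (t x)) * (of_real (sqrt (t x)) * z) = of_real (t x) * z"
    if "x \<in> space M" for x and z :: complex
    using t01[OF that] by (simp flip: mult.assoc of_real_mult)
  ultimately show ?thesis
    by (auto simp: op_root_def effect_op_def mult_op_def ae_eq_def intro!: AE_I2)
qed

section \<open>Conditioning rank one density operators\<close>

text \<open>
  The numerator is the trace of \<open>g \<mapsto> c \<langle>u, R f g\<rangle> R u\<close>, a rank one operator whose functional is
  represented by the complex conjugate of \<open>f\<close> times \<open>R u\<close>.
\<close>

lemma op_state_cond_rank_one:
  assumes onb: "orthonormal_basis M \<phi>" and A: "effect_op M A" and u: "u \<in> L2 M"
    and f: "f \<in> Linf M" and c: "c \<noteq> 0"
    and \<rho>: "\<And>g. g \<in> L2 M \<Longrightarrow> \<rho> g = (\<lambda>x. c * L2_inner M u g * u x)"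
  shows "op_state M (op_cond M \<rho> A) (mult_op f)
    = L2_inner M (op_sqrt M A u) (mult_op f (op_sqrt M A u)) / L2_inner M u (A u)"
proof -
  let ?R = "op_sqrt M A"
  have root: "op_root M A ?R" by (rule op_root_op_sqrt[OF A])
  then have pos: "positive_op M A" "positive_op M ?R"
    using A by (auto simp: op_root_def effect_op_def)
  note bd = pos[THEN positive_op_bounded] bounded_op_mult[OF f]
  note mem = bd[THEN bounded_op_L2]
  have d: "op_state M \<rho> A = c * L2_inner M u (A u)"
    unfolding op_state_def comp_def
  proof (subst op_trace_rank_one[OF onb mem(1)[OF u] u])
    show "\<rho> (A g) \<in> L2 M" if "g \<in> L2 M" for g
      by (simp add: \<rho> mem(1)[OF that] L2_cmult u)
    show "ae_eq M (\<rho> (A g)) (\<lambda>x. c * L2_inner M (A u) g * u x)" if "g \<in> L2 M" for g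
      by (simp add: \<rho> mem(1)[OF that] positive_op_symmetric[OF pos(1) u that] ae_eq_refl)
    show "c * L2_inner M (A u) u = c * L2_inner M u (A u)"
      by (simp add: positive_op_symmetric[OF pos(1) u u])
  qed
  define d where "d = c * L2_inner M u (A u)"
  define w where "w = (\<lambda>x. cnj (f x) * ?R u x)"
  have cnj_f: "(\<lambda>x. cnj (f x)) \<in> Linf M"
    using f by (auto simp: Linf_def)
  have w: "w \<in> L2 M"
    using bounded_op_L2[OF bounded_op_mult[OF cnj_f] mem(2)[OF u]] by (simp add: w_def mult_op_def)
  have "op_state M (op_cond M \<rho> A) (mult_op f) = c / d * L2_inner M w (?R u)"
    unfolding op_state_def comp_def
  proof (rule op_trace_rank_one[OF onb w mem(2)[OF u]])
    fix g assume g: "g \<in> L2 M"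
    let ?h = "?R (mult_op f g)"
    have h: "?h \<in> L2 M" by (intro mem g)
    have cond: "op_cond M \<rho> A (mult_op f g) = (\<lambda>x. ?R (\<lambda>x. c * L2_inner M u ?h * u x) x / d)"
      unfolding op_cond_def d d_def[symmetric] by (simp add: \<rho>[OF h])
    show "op_cond M \<rho> A (mult_op f g) \<in> L2 M"
      unfolding cond by (intro L2_divide mem(2) L2_cmult u)
    have "L2_inner M u ?h = L2_inner M w g"
      using positive_op_symmetric[OF pos(2) u mem(3)[OF g]]
      by (simp add: L2_inner_mult_left w_def)
    then show "ae_eq M (op_cond M \<rho> A (mult_op f g)) (\<lambda>x. c / d * L2_inner M w g * ?R u x)"
      unfolding cond using bounded_op_cmult[OF bd(2) u, of "c * L2_inner M w g"]
      by (auto simp: ae_eq_def elim: eventually_mono)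
  qed
  also have "L2_inner M w (?R u) = L2_inner M (?R u) (mult_op f (?R u))"
    by (simp add: L2_inner_mult_left w_def)
  finally show ?thesis using c by (simp add: d_def)
qed

lemma compress_density_rank_one:
  fixes L :: nat
  assumes onb: "orthonormal_basis M \<phi>" and s: "s \<in> L2 M" and g: "g \<in> L2 M"
  defines "u \<equiv> proj M \<phi> L s"
  shows "compress_density M \<phi> L (\<lambda>g x. L2_inner M s g * s x) g
    = (\<lambda>x. 1 / L2_inner M u u * L2_inner M u g * u x)"
proof -
  have u: "u \<in> L2 M" unfolding u_def by (rule proj_L2[OF onb s])
  have comp: "compress M \<phi> L (\<lambda>g x. L2_inner M s g * s x) g = (\<lambda>x. L2_inner M u g * u x)"
    if "g \<in> L2 M" for g
    by (simp add: compress_def proj_cmult[OF onb s] proj_symmetric[OF onb s that] u_def)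
  have "op_trace M (compress M \<phi> L (\<lambda>g x. L2_inner M s g * s x)) = 1 * L2_inner M u u"
    by (rule op_trace_rank_one[OF onb u u]) (simp_all add: comp L2_cmult u ae_eq_refl)
  then show ?thesis by (simp add: compress_density_def comp[OF g])
qed

text \<open>
  The formula for rank one densities needs \<open>c = 1 / \<parallel>u\<^sub>L\<parallel>\<^sup>2\<close> to be nonzero, which can fail for the first
  indices, where the normalization of the compressed density divides by zero.
\<close>

lemma cond_compress_lim:
  assumes onb: "orthonormal_basis M \<phi>" and A: "effect_op M A" and s: "s \<in> L2 M"
    and f: "f \<in> Linf M" and nz: "L2_inner M s (A s) \<noteq> 0"
  defines "\<rho> \<equiv> \<lambda>g x. L2_inner M s g * s x"
  shows "(\<lambda>L. op_state M (op_cond M (compress_density M \<phi> L \<rho>) (compress M \<phi> L A)) (mult_op f))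
    \<longlonglongrightarrow> op_state M (op_cond M \<rho> A) (mult_op f)"
proof -
  define u where "u L = proj M \<phi> L s" for L
  define AL where "AL L = compress M \<phi> L A" for L
  have u_L2: "u L \<in> L2 M" for L unfolding u_def by (rule proj_L2[OF onb s])
  have AL: "effect_op M (AL L)" for L unfolding AL_def by (rule effect_op_compress[OF onb A])
  have AL_lim: "L2_lim M (\<lambda>L. AL L g) (A g)" if "g \<in> L2 M" for g
    unfolding AL_def by (rule compress_lim[OF onb effect_op_bounded[OF A] that])
  have u_lim: "L2_lim M u s" unfolding u_def by (rule proj_lim[OF onb s])
  let ?q = "\<lambda>A u. L2_inner M (op_sqrt M A u) (mult_op f (op_sqrt M A u)) / L2_inner M u (A u)"
  have R_lim: "L2_lim M (\<lambda>L. op_sqrt M (AL L) (u L)) (op_sqrt M A s)"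
    by (rule op_root_lim[OF AL A AL_lim op_root_op_sqrt[OF AL] op_root_op_sqrt[OF A] u_lim])
  have Au_lim: "L2_lim M (\<lambda>L. AL L (u L)) (A s)"
    by (rule strong_lim_moving[where C=1 and T=AL, OF effect_op_bounded[OF AL] _ AL_lim[OF s] u_lim])
       (simp add: effect_op_contraction(2)[OF AL])
  have lim: "(\<lambda>L. ?q (AL L) (u L)) \<longlonglongrightarrow> ?q A s"
    by (intro tendsto_divide L2_lim_inner bounded_op_lim[OF bounded_op_mult[OF f]] R_lim u_lim
        Au_lim nz)
  have "L2_inner M s s \<noteq> 0"
  proof
    assume "L2_inner M s s = 0"
    then have "L2_norm M s = 0" by (simp add: L2_inner_self)
    then have "L2_inner M s (A s) = 0"
      using L2_inner_bound[OF s bounded_op_L2[OF effect_op_bounded[OF A] s]] by simp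
    with nz show False by simp
  qed
  then have "eventually (\<lambda>L. L2_inner M (u L) (u L) \<noteq> 0) sequentially"
    by (rule tendsto_imp_eventually_ne[OF L2_lim_inner[OF u_lim u_lim]])
  then have "eventually (\<lambda>L. ?q (AL L) (u L)
      = op_state M (op_cond M (compress_density M \<phi> L \<rho>) (AL L)) (mult_op f)) sequentially"
  proof eventually_elim
    case (elim L)
    show ?case unfolding \<rho>_def
      by (rule op_state_cond_rank_one[OF onb AL u_L2 f, symmetric, where c="1 / L2_inner M (u L) (u L)"])
         (use elim compress_density_rank_one[OF onb s, of _ L] in \<open>simp_all add: u_def\<close>)
  qed
  from tendsto_cong[OF this] lim
  have "(\<lambda>L. op_state M (op_cond M (compress_density M \<phi> L \<rho>) (AL L)) (mult_op f)) \<longlonglongrightarrow> ?q A s"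
    by simp
  also have "?q A s = op_state M (op_cond M \<rho> A) (mult_op f)"
    by (rule op_state_cond_rank_one[OF onb A s f, where c=1, symmetric]) (simp_all add: \<rho>_def)
  finally show ?thesis unfolding AL_def .
qed

section \<open>Conditioning a probability density\<close>

text \<open>
  The principal branch jumps across the negative axis, so measurability is read off from the
  coordinates rather than from continuity.
\<close>

lemma measurable_csqrt [measurable]: "csqrt \<in> borel_measurable borel"
proof -
  have "csqrt = (\<lambda>z. Complex (sqrt ((cmod z + Re z) / 2))
      ((if Im z = 0 then 1 else sgn (Im z)) * sqrt ((cmod z - Re z) / 2)))"
    by (simp add: fun_eq_iff complex_eq_iff)
  also have "\<dots> = (\<lambda>z. of_real (sqrt ((cmod z + Re z) / 2)) + \<i> * of_real
      ((if Im z = 0 then 1 else if Im z > 0 then 1 else -1) * sqrt ((cmod z - Re z) / 2)))"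
    by (auto simp: fun_eq_iff complex_eq_iff sgn_real_def)
  also have "\<dots> \<in> borel_measurable borel" by measurable
  finally show ?thesis .
qed

lemma norm_csqrt_square: "(norm (csqrt z))\<^sup>2 = norm z"
  by (metis norm_power power2_csqrt)

lemma density_csqrt_L2:
  assumes "prob_density M p"
  shows "(\<lambda>x. csqrt (p x)) \<in> L2 M"
  using assms unfolding L2_def prob_density_def by (auto simp: norm_csqrt_square)

lemma op_state_cond_Gamma:
  assumes onb: "orthonormal_basis M \<phi>" and f: "f \<in> Linf M" and p: "prob_density M p"
    and t [measurable]: "t \<in> borel_measurable M"
    and t01: "\<And>x. x \<in> space M \<Longrightarrow> 0 \<le> t x \<and> t x \<le> 1"
  defines "e \<equiv> \<lambda>x. complex_of_real (t x)" and "s \<equiv> \<lambda>x. csqrt (p x)"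
  shows "L2_inner M s (mult_op e s) = fun_state M p e"
    and "op_state M (op_cond M (Gamma_density M p) (mult_op e)) (mult_op f)
      = fun_state M (fun_cond M p e) f"
proof -
  have [measurable]: "p \<in> borel_measurable M" "f \<in> borel_measurable M"
    using p f by (auto simp: prob_density_def Linf_def)
  have s: "s \<in> L2 M" unfolding s_def by (rule density_csqrt_L2[OF p])
  have [measurable]: "s \<in> borel_measurable M" "e \<in> borel_measurable M"
    unfolding s_def e_def by measurable
  have "AE x in M. p x \<in> \<real>\<^sub>\<ge>\<^sub>0" using p by (simp add: prob_density_def)
  then have ss: "AE x in M. cnj (s x) * s x = p x"
  proof eventually_elim
    case (elim x)
    then obtain r where r: "p x = of_real r" "0 \<le> r" by (auto elim: nonneg_Reals_cases)
    then show ?case by (simp add: s_def csqrt_of_real_nonneg flip: of_real_mult)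
  qed
  show denom: "L2_inner M s (mult_op e s) = fun_state M p e"
    unfolding L2_inner_def mult_op_def fun_state_def
    by (rule integral_cong_AE) (use ss in \<open>auto elim!: eventually_mono simp: mult_ac\<close>)
  have A: "effect_op M (mult_op e)"
    unfolding e_def by (rule effect_op_mult[OF t t01])
  define v where "v = mult_op (\<lambda>x. complex_of_real (sqrt (t x))) s"
  have v_bd: "bounded_op M (mult_op (\<lambda>x. complex_of_real (sqrt (t x))))"
    using op_root_bounded[OF op_root_mult[OF t t01]] .
  then have v: "v \<in> L2 M" unfolding v_def by (rule bounded_op_L2[OF _ s])
  have [measurable]: "v \<in> borel_measurable M" by (rule L2_measurable[OF v])
  let ?R = "op_sqrt M (mult_op e)"
  have Rv: "ae_eq M (?R s) v"
    unfolding v_def using op_root_mult[OF t t01]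
    by (intro op_root_unique[OF A op_root_op_sqrt[OF A] _ s]) (simp add: e_def)
  have R: "?R s \<in> L2 M" by (rule bounded_op_L2[OF op_root_bounded[OF op_root_op_sqrt[OF A]] s])
  have "L2_inner M (?R s) (mult_op f (?R s)) = L2_inner M v (mult_op f v)"
    by (intro L2_inner_cong_ae R v bounded_op_L2[OF bounded_op_mult[OF f]] Rv
        bounded_op_cong[OF bounded_op_mult[OF f]])
  also have "\<dots> = (\<integral>x. f x * (csqrt (e x) * p x * csqrt (e x)) \<partial>M)"
    unfolding L2_inner_def mult_op_def
  proof (rule integral_cong_AE)
    have "AE x in M. csqrt (e x) = complex_of_real (sqrt (t x))"
      using t01 by (intro AE_I2) (simp add: e_def csqrt_of_real_nonneg)
    then show "AE x in M. cnj (v x) * (f x * v x) = f x * (csqrt (e x) * p x * csqrt (e x))"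
      using ss
    proof eventually_elim
      case (elim x)
      then show ?case by (simp add: v_def mult_op_def elim(2)[symmetric] mult_ac)
    qed
  qed measurable
  finally have num: "L2_inner M (?R s) (mult_op f (?R s))
      = (\<integral>x. f x * (csqrt (e x) * p x * csqrt (e x)) \<partial>M)" .
  have "op_state M (op_cond M (Gamma_density M p) (mult_op e)) (mult_op f)
      = L2_inner M (?R s) (mult_op f (?R s)) / L2_inner M s (mult_op e s)"
    by (rule op_state_cond_rank_one[OF onb A s f, where c=1])
       (simp_all add: Gamma_density_def s_def)
  also have "\<dots> = fun_state M (fun_cond M p e) f"
    unfolding num denom by (simp add: fun_state_def[of _ _ f] fun_cond_def)
  finally show "op_state M (op_cond M (Gamma_density M p) (mult_op e)) (mult_op f)
      = fun_state M (fun_cond M p e) f" .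
qed

theorem mainTheorem5:
  fixes M :: "'x::polish_space measure"
    and \<Phi> :: "real \<Rightarrow> 'x \<Rightarrow> 'x"
    and \<phi> :: "nat \<Rightarrow> 'x \<Rightarrow> complex"
    and N :: "'y measure"
    and h :: "'x \<Rightarrow> 'y"
    and \<psi> :: "'y \<times> 'y \<Rightarrow> real"
    and y :: 'y
    and f p :: "'x \<Rightarrow> complex"
  assumes "ergodic_flow M \<Phi>"
    and "orthonormal_basis M \<phi>"
    and "\<And>j. \<phi> j \<in> Linf M"
    and "h \<in> measurable M N"
    and "\<psi> \<in> borel_measurable (N \<Otimes>\<^sub>M N)"
    and "\<And>u v. u \<in> space N \<Longrightarrow> v \<in> space N \<Longrightarrow> 0 \<le> \<psi> (u, v) \<and> \<psi> (u, v) \<le> 1"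
    and "y \<in> space N"
    and "f \<in> Linf M"
    and "prob_density M p"
    and "fun_state M p (obs_effect \<psi> h y) \<noteq> 0"
  shows "((\<lambda>L. op_state M
             (op_cond M (compress_density M \<phi> L (Gamma_density M p)) (obs_effect_proj M \<phi> \<psi> h L y))
             (mult_op f))
           \<longlonglongrightarrow> op_state M (op_cond M (Gamma_density M p) (obs_effect_op \<psi> h y)) (mult_op f))
         \<and> op_state M (op_cond M (Gamma_density M p) (obs_effect_op \<psi> h y)) (mult_op f)
           = fun_state M (fun_cond M p (obs_effect \<psi> h y)) f"
proof
  define t where "t x = \<psi> (y, h x)" for x
  note [measurable] = assms(4,5)
  have t: "t \<in> borel_measurable M"
    unfolding t_def using assms(7) by measurable
  have t01: "0 \<le> t x \<and> t x \<le> 1" if "x \<in> space M" for x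
    unfolding t_def using assms(6,7) measurable_space[OF assms(4) that] by blast
  have eff: "obs_effect \<psi> h y = (\<lambda>x. complex_of_real (t x))"
    by (simp add: obs_effect_def t_def)
  note cond = op_state_cond_Gamma[OF assms(2,8,9) t t01, folded eff]
  show "op_state M (op_cond M (Gamma_density M p) (obs_effect_op \<psi> h y)) (mult_op f)
      = fun_state M (fun_cond M p (obs_effect \<psi> h y)) f"
    unfolding obs_effect_op_def by (rule cond(2))
  have "effect_op M (mult_op (obs_effect \<psi> h y))"
    unfolding eff by (rule effect_op_mult[OF t t01])
  then show "(\<lambda>L. op_state M
             (op_cond M (compress_density M \<phi> L (Gamma_density M p)) (obs_effect_proj M \<phi> \<psi> h L y))
             (mult_op f))
           \<longlonglongrightarrow> op_state M (op_cond M (Gamma_density M p) (obs_effect_op \<psi> h y)) (mult_op f)"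
    unfolding obs_effect_proj_def obs_effect_op_def Gamma_density_def
    by (rule cond_compress_lim[OF assms(2) _ density_csqrt_L2[OF assms(9)] assms(8)])
       (simp add: cond(1) assms(10))
qed

end
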